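(* Let $A$ be a sequence algebra and let $X\in\mathcal H$. Then $X$ is extremely projective with respect to $\mathcal H$ if and only if both of the following hold: (i) for every $n\in\mathbb N$, the coordinate subspace $X_n$ is extremely projective in $\mathbf{Nor}$ (equivalently, $X_n$ is a near-retract in $\mathbf{Nor}$ of $l_1^0(\Lambda_n)$ for some index set $\Lambda_n$); (ii) $X$ is of finite type. Moreover, if $X\in\mathcal H$ is merely topologically projective with respect to $\mathcal H$, then $X$ is of finite type.
   Context: All normed algebras and modules are contractive: $\|ab\|\le\|a\|\|b\|$ and $\|a\cdot x\|\le\|a\|\|x\|$; modules are left normed $A$-modules, not necessarily complete, and morphisms are bounded $A$-module maps. A morphism $\tau:Y\to X$ is coisometric if $\|\tau\|\le1$ and for every $x\in X$, $\varepsilon>0$ there is $y\in Y$ with $\tau(y)=x$, $\|y\|<\|x\|+\varepsilon$. Given a surjective $\tau:Y\to X$ and $\varphi:P\to X$, a lifting of $\varphi$ with respect to $\tau$ is a morphism $\psi:P\to Y$ with $\tau\psi=\varphi$. For a full subcategory $\mathcal K$ of the category of normed $A$-modules, a normed $A$-module $P$ is extremely projective with respect to $\mathcal K$ if for every coisometric morphism $\tau:Y\to X$ with $X,Y\in\mathcal K$, every bounded morphism $\varphi:P\to X$ and every $\varepsilon>0$ there is a lifting $\psi$ of $\varphi$ with respect to $\tau$ with $\|\psi\|<\|\varphi\|+\varepsilon$; $P$ is topologically projective with respect to $\mathcal K$ if every such $\varphi$ has a bounded lifting. A contractive morphism $\sigma:Y\to X$ is a near-retraction if for every $\varepsilon>0$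 it has a right inverse morphism $\rho$ ($\sigma\rho=1_X$) with $\|\rho\|<1+\varepsilon$; $X$ is a near-retract of $Y$ if such $\sigma$ exists. A normed space is extremely projective in $\mathbf{Nor}$ if it is extremely projective with respect to the category of all normed spaces (modules over $\mathbb C$). For a set $\Lambda$, $l_1^0(\Lambda)$ is the space of finitely supported functions on $\Lambda$ with the $l_1$-norm ($l_1^0(\emptyset)=0$). A sequence algebra is a normed algebra of complex sequences with coordinatewise operations that contains $c_{00}$ (finite sequences) as a dense subalgebra and with $\|\mathbf p^n\|=1$ for all $n$, where $\mathbf p^n$ is the sequence with $1$ in place $n$ and $0$ elsewhere. For an $A$-module $X$ and $x\in X$, write $x_n:=\mathbf p^n\cdot x$ and $X_n:=\{\mathbf p^n\cdot x: x\in X\}$ (the $n$-th coordinate subspace/submodule). $X$ is essential if the closed linear span of $\{a\cdot x\}$ is $X$; homogeneous if for $x,y\in X$, $\|x_n\|\le\|y_n\|$ for all $n$ implies $\|x\|\le\|y\|$; of finite type if for every $x\in X$, $x_n=0$ for all sufficiently large $n$. $\mathcal H$ is the full subcategory of essential homogeneous normed $A$-modules. *)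

theory Defs
  imports Complex_Main
begin

text \<open>A normed space (or normed module over a sequence algebra) is given by a carrier set
 inside some type together with its operations. The field nm_act is the module action of
 sequences (elements of the algebra); it is ignored when the structure is viewed as a mere
 normed space (category Nor).\<close>

record 'x nmod =
  mcar   :: "'x set"
  mzero  :: 'x
  madd   :: "'x \<Rightarrow> 'x \<Rightarrow> 'x"
  msmul  :: "complex \<Rightarrow> 'x \<Rightarrow> 'x"
  mact   :: "(nat \<Rightarrow> complex) \<Rightarrow> 'x \<Rightarrow> 'x"
  mnorm  :: "'x \<Rightarrow> real"

definition normed_sp :: "'x nmod \<Rightarrow> bool" where
  "normed_sp M \<longleftrightarrow>
     mzero M \<in> mcar M \<and>
     (\<forall>x\<in>mcar M. \<forall>y\<in>mcar M. madd M x y \<in> mcar M) \<and>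
     (\<forall>c. \<forall>x\<in>mcar M. msmul M c x \<in> mcar M) \<and>
     (\<forall>x\<in>mcar M. \<forall>y\<in>mcar M. \<forall>z\<in>mcar M. madd M (madd M x y) z = madd M x (madd M y z)) \<and>
     (\<forall>x\<in>mcar M. \<forall>y\<in>mcar M. madd M x y = madd M y x) \<and>
     (\<forall>x\<in>mcar M. madd M x (mzero M) = x) \<and>
     (\<forall>x\<in>mcar M. madd M x (msmul M (-1) x) = mzero M) \<and>
     (\<forall>x\<in>mcar M. msmul M 1 x = x) \<and>
     (\<forall>a b. \<forall>x\<in>mcar M. msmul M a (msmul M b x) = msmul M (a * b) x) \<and>
     (\<forall>a b. \<forall>x\<in>mcar M. msmul M (a + b) x = madd M (msmul M a x) (msmul M b x)) \<and>
     (\<forall>a. \<forall>x\<in>mcar M. \<forall>y\<in>mcar M. msmul M a (madd M x y) = madd M (msmul M a x) (msmul M a y)) \<and>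
     (\<forall>x\<in>mcar M. 0 \<le> mnorm M x) \<and>
     (\<forall>x\<in>mcar M. mnorm M x = 0 \<longleftrightarrow> x = mzero M) \<and>
     (\<forall>c. \<forall>x\<in>mcar M. mnorm M (msmul M c x) = cmod c * mnorm M x) \<and>
     (\<forall>x\<in>mcar M. \<forall>y\<in>mcar M. mnorm M (madd M x y) \<le> mnorm M x + mnorm M y)"

definition pv :: "nat \<Rightarrow> nat \<Rightarrow> complex" where
  "pv n = (\<lambda>k. if k = n then 1 else 0)"

definition seq_algebra :: "(nat \<Rightarrow> complex) set \<Rightarrow> ((nat \<Rightarrow> complex) \<Rightarrow> real) \<Rightarrow> bool" where
  "seq_algebra A nA \<longleftrightarrow>
     (\<lambda>_. 0) \<in> A \<and>
     (\<forall>a\<in>A. \<forall>b\<in>A. (\<lambda>n. a n + b n) \<in> A) \<and>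
     (\<forall>c. \<forall>a\<in>A. (\<lambda>n. c * a n) \<in> A) \<and>
     (\<forall>a\<in>A. \<forall>b\<in>A. (\<lambda>n. a n * b n) \<in> A) \<and>
     (\<forall>a\<in>A. 0 \<le> nA a) \<and>
     (\<forall>a\<in>A. nA a = 0 \<longleftrightarrow> a = (\<lambda>_. 0)) \<and>
     (\<forall>c. \<forall>a\<in>A. nA (\<lambda>n. c * a n) = cmod c * nA a) \<and>
     (\<forall>a\<in>A. \<forall>b\<in>A. nA (\<lambda>n. a n + b n) \<le> nA a + nA b) \<and>
     (\<forall>a\<in>A. \<forall>b\<in>A. nA (\<lambda>n. a n * b n) \<le> nA a * nA b) \<and>
     {a. finite {n. a n \<noteq> 0}} \<subseteq> A \<and>
     (\<forall>a\<in>A. \<forall>e>0. \<exists>b. finite {n. b n \<noteq> 0} \<and> nA (\<lambda>n. a n - b n) < e) \<and>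
     (\<forall>n. nA (pv n) = 1)"

definition nmodule :: "(nat \<Rightarrow> complex) set \<Rightarrow> ((nat \<Rightarrow> complex) \<Rightarrow> real) \<Rightarrow> 'x nmod \<Rightarrow> bool" where
  "nmodule A nA M \<longleftrightarrow> normed_sp M \<and>
     (\<forall>a\<in>A. \<forall>x\<in>mcar M. mact M a x \<in> mcar M) \<and>
     (\<forall>a\<in>A. \<forall>x\<in>mcar M. \<forall>y\<in>mcar M. mact M a (madd M x y) = madd M (mact M a x) (mact M a y)) \<and>
     (\<forall>a\<in>A. \<forall>c. \<forall>x\<in>mcar M. mact M a (msmul M c x) = msmul M c (mact M a x)) \<and>
     (\<forall>a\<in>A. \<forall>b\<in>A. \<forall>x\<in>mcar M. mact M (\<lambda>n. a n + b n) x = madd M (mact M a x) (mact M b x)) \<and>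
     (\<forall>a\<in>A. \<forall>c. \<forall>x\<in>mcar M. mact M (\<lambda>n. c * a n) x = msmul M c (mact M a x)) \<and>
     (\<forall>a\<in>A. \<forall>b\<in>A. \<forall>x\<in>mcar M. mact M (\<lambda>n. a n * b n) x = mact M a (mact M b x)) \<and>
     (\<forall>a\<in>A. \<forall>x\<in>mcar M. mnorm M (mact M a x) \<le> nA a * mnorm M x)"

definition lin_bdd :: "'x nmod \<Rightarrow> 'y nmod \<Rightarrow> ('x \<Rightarrow> 'y) \<Rightarrow> bool" where
  "lin_bdd M N f \<longleftrightarrow>
     (\<forall>x\<in>mcar M. f x \<in> mcar N) \<and>
     (\<forall>x\<in>mcar M. \<forall>y\<in>mcar M. f (madd M x y) = madd N (f x) (f y)) \<and>
     (\<forall>c. \<forall>x\<in>mcar M. f (msmul M c x) = msmul N c (f x)) \<and>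
     (\<exists>C. \<forall>x\<in>mcar M. mnorm N (f x) \<le> C * mnorm M x)"

definition morph :: "(nat \<Rightarrow> complex) set \<Rightarrow> 'x nmod \<Rightarrow> 'y nmod \<Rightarrow> ('x \<Rightarrow> 'y) \<Rightarrow> bool" where
  "morph A M N f \<longleftrightarrow> lin_bdd M N f \<and>
     (\<forall>a\<in>A. \<forall>x\<in>mcar M. f (mact M a x) = mact N a (f x))"

definition opnorm :: "'x nmod \<Rightarrow> 'y nmod \<Rightarrow> ('x \<Rightarrow> 'y) \<Rightarrow> real" where
  "opnorm M N f = Inf {C. 0 \<le> C \<and> (\<forall>x\<in>mcar M. mnorm N (f x) \<le> C * mnorm M x)}"

definition coisometric :: "'x nmod \<Rightarrow> 'y nmod \<Rightarrow> ('x \<Rightarrow> 'y) \<Rightarrow> bool" where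
  "coisometric Y X t \<longleftrightarrow> opnorm Y X t \<le> 1 \<and>
     (\<forall>x\<in>mcar X. \<forall>e>0. \<exists>y\<in>mcar Y. t y = x \<and> mnorm Y y < mnorm X x + e)"

fun msum :: "'x nmod \<Rightarrow> nat \<Rightarrow> (nat \<Rightarrow> 'x) \<Rightarrow> 'x" where
  "msum M 0 f = mzero M"
| "msum M (Suc k) f = madd M (msum M k f) (f k)"

definition lspan :: "'x nmod \<Rightarrow> 'x set \<Rightarrow> 'x set" where
  "lspan M S = {msum M k (\<lambda>i. msmul M (c i) (v i)) | k c v. \<forall>i<k. v i \<in> S}"

definition essential :: "(nat \<Rightarrow> complex) set \<Rightarrow> 'x nmod \<Rightarrow> bool" where
  "essential A M \<longleftrightarrow>
     (\<forall>x\<in>mcar M. \<forall>e>0. \<exists>s\<in>lspan M {mact M a y | a y. a \<in> A \<and> y \<in> mcar M}.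
        mnorm M (madd M x (msmul M (-1) s)) < e)"

definition homogeneous :: "'x nmod \<Rightarrow> bool" where
  "homogeneous M \<longleftrightarrow>
     (\<forall>x\<in>mcar M. \<forall>y\<in>mcar M.
        (\<forall>n. mnorm M (mact M (pv n) x) \<le> mnorm M (mact M (pv n) y)) \<longrightarrow> mnorm M x \<le> mnorm M y)"

definition finite_type :: "'x nmod \<Rightarrow> bool" where
  "finite_type M \<longleftrightarrow> (\<forall>x\<in>mcar M. \<exists>N. \<forall>n\<ge>N. mact M (pv n) x = mzero M)"

definition in_H :: "(nat \<Rightarrow> complex) set \<Rightarrow> ((nat \<Rightarrow> complex) \<Rightarrow> real) \<Rightarrow> 'x nmod \<Rightarrow> bool" where
  "in_H A nA M \<longleftrightarrow> nmodule A nA M \<and> essential A M \<and> homogeneous M"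

definition coord :: "'x nmod \<Rightarrow> nat \<Rightarrow> 'x nmod" where
  "coord M n = M\<lparr>mcar := {mact M (pv n) x | x. x \<in> mcar M}\<rparr>"

definition ext_proj_H :: "(nat \<Rightarrow> complex) set \<Rightarrow> ((nat \<Rightarrow> complex) \<Rightarrow> real) \<Rightarrow> 'p nmod
    \<Rightarrow> 'y itself \<Rightarrow> 'z itself \<Rightarrow> bool" where
  "ext_proj_H A nA P _ _ \<longleftrightarrow>
     (\<forall>(Y::'y nmod) (X::'z nmod) t phi e.
        in_H A nA Y \<and> in_H A nA X \<and> morph A Y X t \<and> coisometric Y X t \<and>
        morph A P X phi \<and> 0 < e \<longrightarrow>
        (\<exists>psi. morph A P Y psi \<and> (\<forall>p\<in>mcar P. t (psi p) = phi p) \<and>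
               opnorm P Y psi < opnorm P X phi + e))"

definition top_proj_H :: "(nat \<Rightarrow> complex) set \<Rightarrow> ((nat \<Rightarrow> complex) \<Rightarrow> real) \<Rightarrow> 'p nmod
    \<Rightarrow> 'y itself \<Rightarrow> 'z itself \<Rightarrow> bool" where
  "top_proj_H A nA P _ _ \<longleftrightarrow>
     (\<forall>(Y::'y nmod) (X::'z nmod) t phi.
        in_H A nA Y \<and> in_H A nA X \<and> morph A Y X t \<and> coisometric Y X t \<and>
        morph A P X phi \<longrightarrow>
        (\<exists>psi. morph A P Y psi \<and> (\<forall>p\<in>mcar P. t (psi p) = phi p)))"

definition ext_proj_Nor :: "'p nmod \<Rightarrow> 'y itself \<Rightarrow> 'z itself \<Rightarrow> bool" where
  "ext_proj_Nor P _ _ \<longleftrightarrow>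
     (\<forall>(Y::'y nmod) (X::'z nmod) t phi e.
        normed_sp Y \<and> normed_sp X \<and> lin_bdd Y X t \<and> coisometric Y X t \<and>
        lin_bdd P X phi \<and> 0 < e \<longrightarrow>
        (\<exists>psi. lin_bdd P Y psi \<and> (\<forall>p\<in>mcar P. t (psi p) = phi p) \<and>
               opnorm P Y psi < opnorm P X phi + e))"

definition l1z :: "'l set \<Rightarrow> ('l \<Rightarrow> complex) nmod" where
  "l1z L = \<lparr> mcar = {f. finite {i. f i \<noteq> 0} \<and> {i. f i \<noteq> 0} \<subseteq> L},
             mzero = (\<lambda>_. 0),
             madd = (\<lambda>f g i. f i + g i),
             msmul = (\<lambda>c f i. c * f i),
             mact = (\<lambda>a f. f),
             mnorm = (\<lambda>f. \<Sum>i\<in>{i. f i \<noteq> 0}. cmod (f i)) \<rparr>"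

definition near_retract :: "'x nmod \<Rightarrow> 'y nmod \<Rightarrow> bool" where
  "near_retract X Y \<longleftrightarrow>
     (\<exists>s. lin_bdd Y X s \<and> opnorm Y X s \<le> 1 \<and>
        (\<forall>e>0. \<exists>r. lin_bdd X Y r \<and> (\<forall>x\<in>mcar X. s (r x) = x) \<and> opnorm X Y r < 1 + e))"

text \<open>A carrier type large enough to host all test objects used in the "only if" directions.\<close>
type_synonym 'a big = "(nat \<times> 'a \<Rightarrow> complex) set"

end

(*
  The difficult point is that a (topologically) projective module X is of finite type. Renorm X by
  the supremum of the norms of its coordinates, and map onto it the c_0-type sum Y of copies of X
  in which the n-th coordinate of a copy is multiplied by a weight w(n) >= 1 tending to infinity.
  Since the coordinates of an element of an essential module tend to zero, it has lifts with
  almost the same norm in a copy whose weight grows slowly enough, so the map is coisometric. But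
  a bounded lifting of the identity of X would stretch the coordinates of x by arbitrarily large
  factors, unless almost all of them vanish.

  Conversely, liftings of the coordinates glue to a morphism because of finite type. Its norm is
  controlled by homogeneity: replace every coordinate of x by a multiple, of the same norm, of a
  vector at which the coordinate of phi almost attains its norm, apply phi, and compare with a
  lift of the result.
*)
theory Submission
  imports Defs "HOL-Algebra.FiniteProduct"
begin

section \<open>Vector spaces and modules on carriers\<close>

text \<open>The given norm of X is determined by the coordinate norms, but by no explicit formula,
  so lifts of controlled norm cannot be written down for it. The supremum norm is explicit, and
  passing to it is harmless: every \<open>pv n\<close> acts contractively, so the identity remains a
  contractive morphism. In the sum Y an element involves only finitely many copies, so all its
  weights are large from some coordinate on. A lifting commutes with \<open>pv n\<close>; its bound
  therefore holds for each coordinate of x separately, and this is what large weights contradict.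

  In the converse, homogeneity compares norms only inside one module. Vectors of X and of Y are
  linked by phi and the coisometry alone, which forces the estimate to travel through phi.

  There is also an obstacle of size, since projectivity is tested on carriers in fixed types. Being
  a near-retract of \<open>l1z\<close> over the unit ball mentions no test module: it comes from
  lifting one single map (the identity in Nor, or the action of \<open>pv n\<close> over the
  algebra), and it yields liftings over arbitrary types.\<close>

locale vec_sp =
  fixes M :: "'x nmod"
  assumes zero_in [simp]: "mzero M \<in> mcar M"
    and add_in [simp]: "x \<in> mcar M \<Longrightarrow> y \<in> mcar M \<Longrightarrow> madd M x y \<in> mcar M"
    and smul_in [simp]: "x \<in> mcar M \<Longrightarrow> msmul M c x \<in> mcar M"
    and add_assoc: "x \<in> mcar M \<Longrightarrow> y \<in> mcar M \<Longrightarrow> z \<in> mcar M \<Longrightarrow>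
      madd M (madd M x y) z = madd M x (madd M y z)"
    and add_comm: "x \<in> mcar M \<Longrightarrow> y \<in> mcar M \<Longrightarrow> madd M x y = madd M y x"
    and add_zero [simp]: "x \<in> mcar M \<Longrightarrow> madd M x (mzero M) = x"
    and add_neg [simp]: "x \<in> mcar M \<Longrightarrow> madd M x (msmul M (-1) x) = mzero M"
    and one_smul [simp]: "x \<in> mcar M \<Longrightarrow> msmul M 1 x = x"
    and smul_smul: "x \<in> mcar M \<Longrightarrow> msmul M a (msmul M b x) = msmul M (a * b) x"
    and smul_add_left: "x \<in> mcar M \<Longrightarrow> msmul M (a + b) x = madd M (msmul M a x) (msmul M b x)"
    and smul_add_right: "x \<in> mcar M \<Longrightarrow> y \<in> mcar M \<Longrightarrow>
      msmul M a (madd M x y) = madd M (msmul M a x) (msmul M a y)"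

locale nrm_sp = vec_sp +
  assumes norm_nonneg [simp]: "x \<in> mcar M \<Longrightarrow> 0 \<le> mnorm M x"
    and norm_eq_0: "x \<in> mcar M \<Longrightarrow> mnorm M x = 0 \<longleftrightarrow> x = mzero M"
    and norm_smul: "x \<in> mcar M \<Longrightarrow> mnorm M (msmul M c x) = cmod c * mnorm M x"
    and norm_triangle: "x \<in> mcar M \<Longrightarrow> y \<in> mcar M \<Longrightarrow>
      mnorm M (madd M x y) \<le> mnorm M x + mnorm M y"

lemma normed_sp_iff: "normed_sp M \<longleftrightarrow> nrm_sp M"
proof
  assume "normed_sp M"
  then show "nrm_sp M"
    unfolding normed_sp_def by (elim conjE, unfold_locales) simp_all
next
  assume "nrm_sp M"
  then interpret nrm_sp M .
  show "normed_sp M"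
    unfolding normed_sp_def
    by (intro conjI ballI allI)
      (simp_all add: add_assoc smul_smul smul_add_left smul_add_right norm_eq_0 norm_smul
        norm_triangle, rule add_comm)
qed

text \<open>The action is axiomatised without a norm, because for modules normed by a supremum the
  norm axioms are derived afterwards, with the help of the action.\<close>

locale act_sp = vec_sp M for A :: "(nat \<Rightarrow> complex) set" and M :: "'x nmod" +
  assumes act_in [simp]: "a \<in> A \<Longrightarrow> x \<in> mcar M \<Longrightarrow> mact M a x \<in> mcar M"
    and act_add: "a \<in> A \<Longrightarrow> x \<in> mcar M \<Longrightarrow> y \<in> mcar M \<Longrightarrow>
      mact M a (madd M x y) = madd M (mact M a x) (mact M a y)"
    and act_smul: "a \<in> A \<Longrightarrow> x \<in> mcar M \<Longrightarrow> mact M a (msmul M c x) = msmul M c (mact M a x)"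
    and add_act: "a \<in> A \<Longrightarrow> b \<in> A \<Longrightarrow> x \<in> mcar M \<Longrightarrow>
      mact M (\<lambda>n. a n + b n) x = madd M (mact M a x) (mact M b x)"
    and smul_act: "a \<in> A \<Longrightarrow> x \<in> mcar M \<Longrightarrow> mact M (\<lambda>n. c * a n) x = msmul M c (mact M a x)"
    and mult_act: "a \<in> A \<Longrightarrow> b \<in> A \<Longrightarrow> x \<in> mcar M \<Longrightarrow>
      mact M (\<lambda>n. a n * b n) x = mact M a (mact M b x)"

lemma nmodule_iff:
  "nmodule A nA M \<longleftrightarrow> nrm_sp M \<and> act_sp A M \<and>
     (\<forall>a\<in>A. \<forall>x\<in>mcar M. mnorm M (mact M a x) \<le> nA a * mnorm M x)"
proof
  assume *: "nmodule A nA M"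
  then interpret nrm_sp M by (simp add: nmodule_def normed_sp_iff)
  have "act_sp A M"
    using * unfolding nmodule_def by (elim conjE, unfold_locales) simp_all
  with * show "nrm_sp M \<and> act_sp A M \<and>
     (\<forall>a\<in>A. \<forall>x\<in>mcar M. mnorm M (mact M a x) \<le> nA a * mnorm M x)"
    by (simp add: nmodule_def normed_sp_iff)
next
  assume *: "nrm_sp M \<and> act_sp A M \<and>
     (\<forall>a\<in>A. \<forall>x\<in>mcar M. mnorm M (mact M a x) \<le> nA a * mnorm M x)"
  then interpret act_sp A M by blast
  from * show "nmodule A nA M"
    by (simp add: nmodule_def normed_sp_iff act_add act_smul add_act smul_act mult_act)
qed

section \<open>Finite sums of vectors\<close>

definition add_monoid :: "'x nmod \<Rightarrow> 'x monoid" where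
  "add_monoid M = \<lparr>carrier = mcar M, monoid.mult = madd M, one = mzero M\<rparr>"

lemma add_monoid_simps [simp]:
  "carrier (add_monoid M) = mcar M" "monoid.mult (add_monoid M) = madd M"
  "one (add_monoid M) = mzero M"
  by (simp_all add: add_monoid_def)

text \<open>The index set is the support, so families over a whole type can be summed. For an
  infinite support \<open>finprod\<close> returns the neutral element, which keeps the sum in the
  carrier in every case.\<close>

definition fsum :: "'x nmod \<Rightarrow> ('i \<Rightarrow> 'x) \<Rightarrow> 'x" where
  "fsum M g = finprod (add_monoid M) g {i. g i \<noteq> mzero M}"

context vec_sp
begin

lemma zero_add [simp]: "x \<in> mcar M \<Longrightarrow> madd M (mzero M) x = x"
  by (metis add_comm add_zero zero_in)

lemma neg_add [simp]: "x \<in> mcar M \<Longrightarrow> madd M (msmul M (-1) x) x = mzero M"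
  by (metis add_comm add_neg smul_in)

lemma zero_smul [simp]: "x \<in> mcar M \<Longrightarrow> msmul M 0 x = mzero M"
  using smul_add_left[of x 1 "-1"] by simp

lemma smul_zero [simp]: "msmul M c (mzero M) = mzero M"
  using smul_smul[of "mzero M" c 0] by simp

lemma idem_zero: "x \<in> mcar M \<Longrightarrow> madd M x x = x \<Longrightarrow> x = mzero M"
  by (metis add_assoc add_neg add_zero smul_in)

lemma diff_zero_eq:
  assumes "x \<in> mcar M" "y \<in> mcar M" "madd M x (msmul M (-1) y) = mzero M"
  shows "x = y"
  by (metis add_assoc add_zero assms neg_add smul_in zero_add)

lemma add_left_comm:
  "x \<in> mcar M \<Longrightarrow> y \<in> mcar M \<Longrightarrow> z \<in> mcar M \<Longrightarrow> madd M x (madd M y z) = madd M y (madd M x z)"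
  by (metis add_assoc add_comm)

lemma add_diff_add:
  assumes "x \<in> mcar M" "y \<in> mcar M" "u \<in> mcar M" "v \<in> mcar M"
  shows "madd M (madd M x y) (msmul M (-1) (madd M u v)) =
    madd M (madd M x (msmul M (-1) u)) (madd M y (msmul M (-1) v))"
  using assms by (simp add: smul_add_right add_assoc add_left_comm)

lemma diff_chain:
  assumes "x \<in> mcar M" "y \<in> mcar M" "z \<in> mcar M"
  shows "madd M x (msmul M (-1) z) =
    madd M (madd M x (msmul M (-1) y)) (madd M y (msmul M (-1) z))"
proof -
  have "madd M (msmul M (-1) y) (madd M y (msmul M (-1) z)) = msmul M (-1) z"
    using assms by (simp flip: add_assoc)
  then show ?thesis
    using assms by (simp add: add_assoc)
qed

lemma comm_monoid_add: "comm_monoid (add_monoid M)"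
  by unfold_locales (auto simp: add_assoc intro: add_comm)

lemma fsum_eq:
  assumes "finite S" "{i. g i \<noteq> mzero M} \<subseteq> S" "\<And>i. g i \<in> mcar M"
  shows "fsum M g = finprod (add_monoid M) g S"
  unfolding fsum_def
  by (rule comm_monoid.finprod_mono_neutral_cong_left[OF comm_monoid_add]) (use assms in auto)

lemma fsum_in [simp]: "(\<And>i. g i \<in> mcar M) \<Longrightarrow> fsum M g \<in> mcar M"
  using comm_monoid.finprod_closed[OF comm_monoid_add, of g] unfolding fsum_def by auto

lemma fsum_add:
  assumes "finite {i. g i \<noteq> mzero M}" "finite {i. h i \<noteq> mzero M}"
    "\<And>i. g i \<in> mcar M" "\<And>i. h i \<in> mcar M"
  shows "fsum M (\<lambda>i. madd M (g i) (h i)) = madd M (fsum M g) (fsum M h)"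
proof -
  let ?S = "{i. g i \<noteq> mzero M} \<union> {i. h i \<noteq> mzero M}"
  have "fsum M (\<lambda>i. madd M (g i) (h i)) = finprod (add_monoid M) (\<lambda>i. madd M (g i) (h i)) ?S"
    by (rule fsum_eq) (use assms in auto)
  also have "\<dots> = madd M (finprod (add_monoid M) g ?S) (finprod (add_monoid M) h ?S)"
    using comm_monoid.finprod_multf[OF comm_monoid_add, of g ?S h] assms by auto
  also have "\<dots> = madd M (fsum M g) (fsum M h)"
    using fsum_eq[of ?S g] fsum_eq[of ?S h] assms by auto
  finally show ?thesis .
qed

lemma fsum_single:
  assumes "x \<in> mcar M"
  shows "fsum M (\<lambda>i. if i = j then x else mzero M) = x"
proof -
  interpret comm_monoid "add_monoid M" by (rule comm_monoid_add)
  have "fsum M (\<lambda>i. if i = j then x else mzero M) =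
      finprod (add_monoid M) (\<lambda>i. if i = j then x else mzero M) {j}"
    by (rule fsum_eq) (use assms in auto)
  then show ?thesis
    using assms by simp
qed

end

lemma additive_zero:
  assumes "vec_sp M" "vec_sp N" "\<And>x. x \<in> mcar M \<Longrightarrow> f x \<in> mcar N"
    "\<And>x y. x \<in> mcar M \<Longrightarrow> y \<in> mcar M \<Longrightarrow> f (madd M x y) = madd N (f x) (f y)"
  shows "f (mzero M) = mzero N"
  using assms by (metis vec_sp.add_zero vec_sp.idem_zero vec_sp.zero_in)

text \<open>Only additivity is asked for, so that one lemma serves bounded maps, scalar
  multiplication, the action of an algebra element and evaluation of functions at a point.\<close>

lemma fsum_hom:
  assumes M: "vec_sp M" and N: "vec_sp N" and f: "\<And>x. x \<in> mcar M \<Longrightarrow> f x \<in> mcar N"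
    and add: "\<And>x y. x \<in> mcar M \<Longrightarrow> y \<in> mcar M \<Longrightarrow> f (madd M x y) = madd N (f x) (f y)"
    and fin: "finite {i. g i \<noteq> mzero M}" and g: "\<And>i. g i \<in> mcar M"
  shows "f (fsum M g) = fsum N (\<lambda>i. f (g i))"
proof -
  interpret M: comm_monoid "add_monoid M" by (rule vec_sp.comm_monoid_add[OF M])
  interpret N: comm_monoid "add_monoid N" by (rule vec_sp.comm_monoid_add[OF N])
  have f0: "f (mzero M) = mzero N"
    by (rule additive_zero[OF M N f add])
  have "f (finprod (add_monoid M) g S) = finprod (add_monoid N) (\<lambda>i. f (g i)) S" if "finite S" for S
    using that
  proof induction
    case (insert j S)
    have "finprod (add_monoid M) g S \<in> mcar M"
      using M.finprod_closed[of g S] g by auto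
    then show ?case
      using insert g f by (simp add: add Pi_def)
  qed (simp add: f0)
  then show ?thesis
    using fin vec_sp.fsum_eq[OF N, of "{i. g i \<noteq> mzero M}" "\<lambda>i. f (g i)"] f g f0
    unfolding fsum_def[of M] by force
qed

context nrm_sp
begin

lemma norm_zero [simp]: "mnorm M (mzero M) = 0"
  by (simp add: norm_eq_0)

lemma norm_diff_commute:
  assumes "x \<in> mcar M" "y \<in> mcar M"
  shows "mnorm M (madd M x (msmul M (-1) y)) = mnorm M (madd M y (msmul M (-1) x))"
proof -
  have "msmul M (-1) (madd M x (msmul M (-1) y)) = madd M y (msmul M (-1) x)"
    using assms by (simp add: smul_add_right smul_smul add_comm)
  then show ?thesis
    using norm_smul[of "madd M x (msmul M (-1) y)" "-1"] assms by simp
qed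

lemma norm_fsum_le:
  assumes "finite S" "{i. g i \<noteq> mzero M} \<subseteq> S" "\<And>i. g i \<in> mcar M"
  shows "mnorm M (fsum M g) \<le> (\<Sum>i\<in>S. mnorm M (g i))"
proof -
  interpret comm_monoid "add_monoid M" by (rule comm_monoid_add)
  have "mnorm M (finprod (add_monoid M) g S) \<le> (\<Sum>i\<in>S. mnorm M (g i))"
    using assms(1)
  proof induction
    case (insert j S)
    have "finprod (add_monoid M) g S \<in> mcar M"
      using finprod_closed[of g S] assms(3) by auto
    then show ?case
      using insert assms(3) norm_triangle[of "g j" "finprod (add_monoid M) g S"]
      by (simp add: Pi_def)
  qed simp
  then show ?thesis
    using fsum_eq[of S g] assms by simp
qed

end

section \<open>Operator norms\<close>

lemma opnorm_ge0:
  assumes "lin_bdd M N f" "nrm_sp M"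
  shows "0 \<le> opnorm M N f"
proof -
  obtain C where C: "\<forall>x\<in>mcar M. mnorm N (f x) \<le> C * mnorm M x"
    using assms unfolding lin_bdd_def by blast
  \<comment> \<open>The constant in \<open>lin_bdd\<close> may be negative on the zero space,
    whereas \<open>opnorm\<close> is an infimum over nonnegative bounds; hence the absolute
    value.\<close>
  have "C * mnorm M x \<le> \<bar>C\<bar> * mnorm M x" if "x \<in> mcar M" for x
    by (simp add: assms(2) mult_right_mono nrm_sp.norm_nonneg that)
  then have "\<bar>C\<bar> \<in> {C. 0 \<le> C \<and> (\<forall>x\<in>mcar M. mnorm N (f x) \<le> C * mnorm M x)}"
    using C by force
  then have ne: "{C. 0 \<le> C \<and> (\<forall>x\<in>mcar M. mnorm N (f x) \<le> C * mnorm M x)} \<noteq> {}"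
    by blast
  show ?thesis
    unfolding opnorm_def by (rule cInf_greatest[OF ne]) auto
qed

lemma opnorm_le:
  assumes "0 \<le> C" "\<And>x. x \<in> mcar M \<Longrightarrow> mnorm N (f x) \<le> C * mnorm M x"
  shows "opnorm M N f \<le> C"
  unfolding opnorm_def by (rule cInf_lower) (use assms in \<open>auto intro!: bdd_belowI[of _ 0]\<close>)

text \<open>The infimum is attained: for \<open>mnorm M x\<close> positive, the quotient of the two
  norms lies below every admissible constant; for \<open>mnorm M x = 0\<close>, any admissible
  constant already gives the claim.\<close>

lemma norm_le_opnorm:
  assumes "lin_bdd M N f" "nrm_sp M" "x \<in> mcar M"
  shows "mnorm N (f x) \<le> opnorm M N f * mnorm M x"
proof -
  let ?S = "{C. 0 \<le> C \<and> (\<forall>x\<in>mcar M. mnorm N (f x) \<le> C * mnorm M x)}"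
  interpret M: nrm_sp M by fact
  obtain C where C: "\<forall>x\<in>mcar M. mnorm N (f x) \<le> C * mnorm M x"
    using assms unfolding lin_bdd_def by blast
  have "C * mnorm M x \<le> \<bar>C\<bar> * mnorm M x" if "x \<in> mcar M" for x
    by (simp add: mult_right_mono that)
  then have ne: "\<bar>C\<bar> \<in> ?S"
    using C by force
  show ?thesis
  proof (cases "mnorm M x = 0")
    case True
    then show ?thesis using C assms(3) by force
  next
    case False
    then have pos: "0 < mnorm M x" using M.norm_nonneg[OF assms(3)] by linarith
    have "mnorm N (f x) / mnorm M x \<le> Inf ?S"
    proof (rule cInf_greatest)
      show "?S \<noteq> {}" using ne by blast
    qed (use pos assms(3) in \<open>auto simp: divide_le_eq\<close>)
    then show ?thesis
      using pos by (simp add: opnorm_def divide_le_eq)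
  qed
qed

lemma norm_le_of_opnorm_le:
  assumes "lin_bdd M N f" "nrm_sp M" "opnorm M N f \<le> C" "x \<in> mcar M"
  shows "mnorm N (f x) \<le> C * mnorm M x"
  using norm_le_opnorm[OF assms(1,2,4)] mult_right_mono[OF assms(3) nrm_sp.norm_nonneg[OF assms(2,4)]]
  by linarith

text \<open>A positive norm divided by \<open>1 + e\<close> lies below the infimum, so some
  \<open>x\<close> violates that bound, and normalising it gives \<open>v\<close>. The slack is a
  factor rather than a summand, so that one \<open>e\<close> can serve infinitely many coordinates
  at once.\<close>

lemma opnorm_almost_attained:
  assumes f: "lin_bdd M N f" and M: "nrm_sp M" and N: "nrm_sp N"
    and e: "0 < e"
  shows "\<exists>v\<in>mcar M. mnorm M v \<le> 1 \<and> opnorm M N f \<le> (1 + e) * mnorm N (f v)"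
proof -
  interpret M: nrm_sp M by fact
  interpret N: nrm_sp N by fact
  let ?K = "opnorm M N f"
  have f0: "f (mzero M) = mzero N"
    by (rule additive_zero[OF M.vec_sp_axioms N.vec_sp_axioms]) (use f in \<open>auto simp: lin_bdd_def\<close>)
  have K0: "0 \<le> ?K" by (rule opnorm_ge0[OF f M])
  show ?thesis
  proof (cases "?K = 0")
    case True
    then show ?thesis using f0 by (intro bexI[of _ "mzero M"]) auto
  next
    case False
    then have "?K / (1 + e) < ?K" using K0 e by (simp add: field_simps)
    then have "\<not> (\<forall>x\<in>mcar M. mnorm N (f x) \<le> ?K / (1 + e) * mnorm M x)"
      using opnorm_le[of "?K / (1 + e)" M N f] K0 e by (meson divide_nonneg_pos add_pos_pos zero_less_one not_le)
    then obtain x where x: "x \<in> mcar M" "?K / (1 + e) * mnorm M x < mnorm N (f x)"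
      by (auto simp: not_le)
    then have nz: "mnorm M x \<noteq> 0"
      using f0 M.norm_eq_0[OF x(1)] by auto
    then have pos: "0 < mnorm M x" using M.norm_nonneg[OF x(1)] by linarith
    let ?v = "msmul M (complex_of_real (1 / mnorm M x)) x"
    have "f ?v = msmul N (complex_of_real (1 / mnorm M x)) (f x)"
      using f x(1) by (simp add: lin_bdd_def)
    moreover have "f x \<in> mcar N" using f x(1) by (simp add: lin_bdd_def)
    ultimately have "mnorm N (f ?v) = mnorm N (f x) / mnorm M x"
      using pos by (simp only: N.norm_smul norm_of_real) simp
    moreover have "?K \<le> (1 + e) * (mnorm N (f x) / mnorm M x)"
      using x(2) pos e by (simp add: field_simps)
    moreover have "mnorm M ?v \<le> 1"
      using pos x(1) by (simp only: M.norm_smul norm_of_real) simp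
    ultimately show ?thesis
      using x(1) by (intro bexI[of _ ?v]) auto
  qed
qed

section \<open>Sequence algebras and homogeneous modules\<close>

locale seq_alg =
  fixes A :: "(nat \<Rightarrow> complex) set" and nA :: "(nat \<Rightarrow> complex) \<Rightarrow> real"
  assumes seq_algebra: "seq_algebra A nA"
begin

lemma finite_in: "finite {n. a n \<noteq> 0} \<Longrightarrow> a \<in> A"
  using seq_algebra unfolding seq_algebra_def by blast

lemma pv_in [simp]: "pv n \<in> A"
  by (rule finite_in) (simp add: pv_def)

lemma alg_add [simp]: "a \<in> A \<Longrightarrow> b \<in> A \<Longrightarrow> (\<lambda>n. a n + b n) \<in> A"
  using seq_algebra unfolding seq_algebra_def by blast

lemma alg_smul [simp]: "a \<in> A \<Longrightarrow> (\<lambda>n. c * a n) \<in> A"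
  using seq_algebra unfolding seq_algebra_def by blast

lemma alg_mult [simp]: "a \<in> A \<Longrightarrow> b \<in> A \<Longrightarrow> (\<lambda>n. a n * b n) \<in> A"
  using seq_algebra unfolding seq_algebra_def by blast

lemma alg_norm_nonneg: "a \<in> A \<Longrightarrow> 0 \<le> nA a"
  using seq_algebra unfolding seq_algebra_def by blast

lemma norm_pv [simp]: "nA (pv n) = 1"
  using seq_algebra unfolding seq_algebra_def by blast

lemma finite_dense:
  "a \<in> A \<Longrightarrow> 0 < e \<Longrightarrow> \<exists>b. finite {n. b n \<noteq> 0} \<and> nA (\<lambda>n. a n - b n) < e"
  using seq_algebra unfolding seq_algebra_def by blast

lemma pv_mult: "(\<lambda>k. pv n k * a k) = (\<lambda>k. a n * pv n k)"
  by (auto simp: pv_def)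

lemma mult_pv: "(\<lambda>k. a k * pv n k) = (\<lambda>k. a n * pv n k)"
  by (auto simp: pv_def)

text \<open>Multiplication by \<open>pv n\<close> turns \<open>a\<close> into \<open>a n\<close>
  times \<open>pv n\<close>, and \<open>pv n\<close> has norm one.\<close>

lemma norm_coord_le:
  assumes "a \<in> A"
  shows "cmod (a n) \<le> nA a"
proof -
  have "nA (\<lambda>k. a n * pv n k) = cmod (a n) * nA (pv n)"
    using seq_algebra pv_in unfolding seq_algebra_def by blast
  moreover have "nA (\<lambda>k. pv n k * a k) \<le> nA (pv n) * nA a"
    using seq_algebra pv_in assms unfolding seq_algebra_def by blast
  ultimately show ?thesis
    by (simp add: pv_mult)
qed

end

text \<open>The sum of the coordinate idempotents with index below \<open>N\<close>. Its action
  truncates a vector and plays the role of an approximate identity.\<close>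

definition initial :: "nat \<Rightarrow> nat \<Rightarrow> complex" where
  "initial N = (\<lambda>k. if k < N then 1 else 0)"

lemma (in seq_alg) initial_in [simp]: "initial N \<in> A"
  by (rule finite_in) (auto simp: initial_def)

lemma pv_apply: "pv n k = (if k = n then 1 else 0)"
  by (simp add: pv_def)

lemma initial_apply: "initial N k = (if k < N then 1 else 0)"
  by (simp add: initial_def)

locale seq_act = seq_alg A nA + act_sp A M
  for A :: "(nat \<Rightarrow> complex) set" and nA and M :: "'x nmod"
begin

lemma pv_act: "a \<in> A \<Longrightarrow> x \<in> mcar M \<Longrightarrow>
  mact M (pv n) (mact M a x) = msmul M (a n) (mact M (pv n) x)"
  using mult_act[OF pv_in, of a x n] smul_act[OF pv_in, of x "a n" n] by (simp only: pv_mult)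

lemma act_pv: "a \<in> A \<Longrightarrow> x \<in> mcar M \<Longrightarrow>
  mact M a (mact M (pv n) x) = msmul M (a n) (mact M (pv n) x)"
  using mult_act[OF _ pv_in, of a x n] smul_act[OF pv_in, of x "a n" n] mult_pv[of a n] by metis

lemma pv_pv: "x \<in> mcar M \<Longrightarrow>
  mact M (pv m) (mact M (pv n) x) = (if m = n then mact M (pv n) x else mzero M)"
  by (subst act_pv) (auto simp: pv_apply)

lemma act_zero [simp]: "a \<in> A \<Longrightarrow> mact M a (mzero M) = mzero M"
  using act_smul[of a "mzero M" 0] by simp

lemma act_diff: "a \<in> A \<Longrightarrow> x \<in> mcar M \<Longrightarrow> y \<in> mcar M \<Longrightarrow>
  mact M a (madd M x (msmul M (-1) y)) = madd M (mact M a x) (msmul M (-1) (mact M a y))"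
  by (simp add: act_add act_smul)

lemma diff_act:
  assumes "a \<in> A" "b \<in> A" "x \<in> mcar M"
  shows "mact M (\<lambda>n. a n - b n) x = madd M (mact M a x) (msmul M (-1) (mact M b x))"
proof -
  have "mact M (\<lambda>n. a n - b n) x = mact M (\<lambda>n. a n + (-1) * b n) x"
    by simp
  also have "\<dots> = madd M (mact M a x) (mact M (\<lambda>n. (-1) * b n) x)"
    using assms by (intro add_act alg_smul) auto
  also have "mact M (\<lambda>n. (-1) * b n) x = msmul M (-1) (mact M b x)"
    using assms by (intro smul_act) auto
  finally show ?thesis .
qed

end

locale H_mod = seq_alg A nA
  for A :: "(nat \<Rightarrow> complex) set" and nA and M :: "'x nmod" +
  assumes in_H: "in_H A nA M"

sublocale H_mod \<subseteq> nrm_sp M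
  using in_H by (simp add: in_H_def nmodule_iff)

sublocale H_mod \<subseteq> seq_act A nA M
  using in_H by (simp add: in_H_def nmodule_iff seq_act_def seq_alg_axioms)

context H_mod
begin

lemma norm_act_le: "a \<in> A \<Longrightarrow> x \<in> mcar M \<Longrightarrow> mnorm M (mact M a x) \<le> nA a * mnorm M x"
  using in_H by (simp add: in_H_def nmodule_iff)

lemma norm_pv_act_le: "x \<in> mcar M \<Longrightarrow> mnorm M (mact M (pv n) x) \<le> mnorm M x"
  using norm_act_le[of "pv n" x] by simp

lemma norm_mono:
  "x \<in> mcar M \<Longrightarrow> y \<in> mcar M \<Longrightarrow>
    (\<And>n. mnorm M (mact M (pv n) x) \<le> mnorm M (mact M (pv n) y)) \<Longrightarrow> mnorm M x \<le> mnorm M y"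
  using in_H by (simp add: in_H_def homogeneous_def)

text \<open>Homogeneity is used against the zero vector. As a consequence coordinates separate
  points, and equations in a homogeneous module can be checked coordinatewise.\<close>

lemma eq_zeroI:
  assumes "x \<in> mcar M" "\<And>n. mact M (pv n) x = mzero M"
  shows "x = mzero M"
proof -
  have "mnorm M x \<le> mnorm M (mzero M)"
    by (rule norm_mono) (use assms in auto)
  then have "mnorm M x = 0"
    using norm_nonneg[OF assms(1)] by simp
  then show ?thesis
    using norm_eq_0[OF assms(1)] by simp
qed

lemma coord_eqI:
  assumes "x \<in> mcar M" "y \<in> mcar M" "\<And>n. mact M (pv n) x = mact M (pv n) y"
  shows "x = y"
  by (rule diff_zero_eq, rule assms(1), rule assms(2), rule eq_zeroI)
    (use assms in \<open>simp_all add: act_diff\<close>)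

text \<open>The algebra norm of \<open>initial N\<close> may grow with \<open>N\<close> (in l_1 it
  equals \<open>N\<close>); it is homogeneity that makes truncations contractive on the
  module.\<close>

lemma norm_initial_le: "x \<in> mcar M \<Longrightarrow> mnorm M (mact M (initial N) x) \<le> mnorm M x"
  by (rule norm_mono) (auto simp: pv_act norm_smul initial_apply)

text \<open>With \<open>P\<close> the truncation, z - Pz = (z - s) + (s - Ps) + P(s - z), and
  \<open>P\<close> is contractive. Tails thus have to be estimated only for approximants
  \<open>s\<close>.\<close>

lemma norm_diff_initial_le:
  assumes "z \<in> mcar M" "s \<in> mcar M"
  shows "mnorm M (madd M z (msmul M (-1) (mact M (initial N) z))) \<le>
    2 * mnorm M (madd M z (msmul M (-1) s)) +
    mnorm M (madd M s (msmul M (-1) (mact M (initial N) s)))"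
proof -
  let ?P = "mact M (initial N)" and ?d = "\<lambda>x y. madd M x (msmul M (-1) y)"
  have "?d z (?P z) = madd M (?d z s) (?d s (?P z))"
    using assms by (intro diff_chain) auto
  also have "?d s (?P z) = madd M (?d s (?P s)) (?P (?d s z))"
    using assms diff_chain[of s "?P s" "?P z"] by (simp add: act_diff)
  finally have "mnorm M (?d z (?P z)) = mnorm M (madd M (?d z s) (madd M (?d s (?P s)) (?P (?d s z))))"
    by simp
  also have "\<dots> \<le> mnorm M (?d z s) + (mnorm M (?d s (?P s)) + mnorm M (?P (?d s z)))"
    using assms
    by (intro norm_triangle[THEN order_trans] add_left_mono) auto
  also have "mnorm M (?P (?d s z)) \<le> mnorm M (?d z s)"
    using norm_initial_le[of "?d s z" N] norm_diff_commute[of s z] assms by simp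
  finally show ?thesis
    by simp
qed

text \<open>Induction on the number of summands. In the new summand, a multiple of \<open>a\<close>
  acting on \<open>y\<close>, the element \<open>a\<close> is close to a finite sequence
  \<open>b\<close>, and whatever \<open>b\<close> produces is fixed by all late truncations.\<close>

lemma initial_dense_span:
  assumes "\<And>i. i < k \<Longrightarrow> v i \<in> {mact M a y | a y. a \<in> A \<and> y \<in> mcar M}" "0 < e"
  shows "msum M k (\<lambda>i. msmul M (c i) (v i)) \<in> mcar M \<and>
    (\<exists>N. \<forall>n\<ge>N. mnorm M (madd M (msum M k (\<lambda>i. msmul M (c i) (v i)))
      (msmul M (-1) (mact M (initial n) (msum M k (\<lambda>i. msmul M (c i) (v i)))))) < e)"
  using assms
proof (induction k arbitrary: e)
  case (Suc k)
  let ?s = "msum M k (\<lambda>i. msmul M (c i) (v i))" and ?d = "\<lambda>x y. madd M x (msmul M (-1) y)"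
  obtain N1 where s: "?s \<in> mcar M"
    and N1: "\<And>n. n \<ge> N1 \<Longrightarrow> mnorm M (?d ?s (mact M (initial n) ?s)) < e / 2"
    using Suc.IH[of "e / 2"] Suc.prems by auto
  obtain a y where a: "a \<in> A" and y: "y \<in> mcar M" and v: "v k = mact M a y"
    using Suc.prems(1)[of k] by auto
  let ?w = "msmul M (c k) y"
  have w: "?w \<in> mcar M" and cv: "msmul M (c k) (v k) = mact M a ?w"
    using a y by (simp_all add: v act_smul)
  \<comment> \<open>The error on \<open>?w\<close> has to stay below \<open>e / 4\<close>, since
    \<open>norm_diff_initial_le\<close> doubles it and the other half of \<open>e\<close> is spent
    on the earlier summands. The \<open>+ 1\<close> covers a vector \<open>?w\<close> of norm
    zero.\<close>
  define e' where "e' = e / (4 * (mnorm M ?w + 1))"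
  have e': "0 < e'"
    using Suc.prems(2) norm_nonneg[OF w] unfolding e'_def
    by (intro divide_pos_pos mult_pos_pos add_nonneg_pos) auto
  obtain b where b: "finite {n. b n \<noteq> 0}" "nA (\<lambda>n. a n - b n) < e'"
    using finite_dense[OF a e'] by blast
  have bA: "b \<in> A" by (rule finite_in[OF b(1)])
  have abA: "(\<lambda>n. a n - b n) \<in> A"
    using alg_add[OF a alg_smul[OF bA, of "-1"]] by simp
  have "mnorm M (?d (mact M a ?w) (mact M b ?w)) \<le> nA (\<lambda>n. a n - b n) * mnorm M ?w"
    using norm_act_le[OF abA w] by (simp add: diff_act a bA w)
  also have "\<dots> \<le> e' * mnorm M ?w"
    using b(2) norm_nonneg[OF w] by (simp add: mult_right_mono)
  also have "\<dots> < e / 4"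
    using norm_nonneg[OF w] Suc.prems(2) by (simp add: e'_def field_simps)
  finally have ab: "mnorm M (?d (mact M a ?w) (mact M b ?w)) < e / 4" .
  obtain N2 where N2: "\<And>n. b n \<noteq> 0 \<Longrightarrow> n < N2"
    using b(1) finite_nat_set_iff_bounded by auto
  have fixb: "mact M (initial n) (mact M b ?w) = mact M b ?w" if "n \<ge> N2" for n
  proof -
    have "(\<lambda>k. initial n k * b k) = b"
    proof
      fix k
      show "initial n k * b k = b k"
        using N2[of k] that by (cases "b k = 0") (auto simp: initial_apply)
    qed
    then show ?thesis
      using mult_act[of "initial n" b ?w] bA w by simp
  qed
  have vN: "mnorm M (?d (mact M a ?w) (mact M (initial n) (mact M a ?w))) < e / 2" if "n \<ge> N2" for n
    using norm_diff_initial_le[of "mact M a ?w" "mact M b ?w" n] ab that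
    by (simp add: a bA w fixb)
  have "mnorm M (?d (madd M ?s (mact M a ?w)) (mact M (initial n) (madd M ?s (mact M a ?w)))) < e"
    if "n \<ge> max N1 N2" for n
  proof -
    have "?d (madd M ?s (mact M a ?w)) (mact M (initial n) (madd M ?s (mact M a ?w))) =
      madd M (?d ?s (mact M (initial n) ?s)) (?d (mact M a ?w) (mact M (initial n) (mact M a ?w)))"
      using s a w by (simp add: act_add add_diff_add)
    then show ?thesis
      using norm_triangle[of "?d ?s (mact M (initial n) ?s)" "?d (mact M a ?w) (mact M (initial n) (mact M a ?w))"]
        N1[of n] vN[of n] that s a w by simp
  qed
  then have "\<exists>N. \<forall>n\<ge>N. mnorm M (?d (madd M ?s (mact M a ?w)) (mact M (initial n) (madd M ?s (mact M a ?w)))) < e"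
    by blast
  then show ?case
    using s a w by (simp add: cv)
qed auto

lemma initial_dense:
  assumes x: "x \<in> mcar M" and e: "0 < e"
  shows "\<exists>N. \<forall>n\<ge>N. mnorm M (madd M x (msmul M (-1) (mact M (initial n) x))) < e"
proof -
  have "\<exists>s\<in>lspan M {mact M a y | a y. a \<in> A \<and> y \<in> mcar M}. mnorm M (madd M x (msmul M (-1) s)) < e / 4"
    using in_H x e unfolding in_H_def essential_def by (meson divide_pos_pos zero_less_numeral)
  then obtain k c v where v: "\<And>i. i < k \<Longrightarrow> v i \<in> {mact M a y | a y. a \<in> A \<and> y \<in> mcar M}"
    and xs: "mnorm M (madd M x (msmul M (-1) (msum M k (\<lambda>i. msmul M (c i) (v i))))) < e / 4"
    unfolding lspan_def by blast
  define s where "s = msum M k (\<lambda>i. msmul M (c i) (v i))"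
  have "s \<in> mcar M \<and> (\<exists>N. \<forall>n\<ge>N. mnorm M (madd M s (msmul M (-1) (mact M (initial n) s))) < e / 2)"
    unfolding s_def by (rule initial_dense_span) (use v e in auto)
  then obtain N where s: "s \<in> mcar M"
    and N: "\<And>n. n \<ge> N \<Longrightarrow> mnorm M (madd M s (msmul M (-1) (mact M (initial n) s))) < e / 2"
    by blast
  have "mnorm M (madd M x (msmul M (-1) (mact M (initial n) x))) < e" if "n \<ge> N" for n
    using norm_diff_initial_le[OF x s, of n] N[OF that] xs unfolding s_def by linarith
  then show ?thesis
    by blast
qed

text \<open>For \<open>n \<ge> N\<close> the \<open>n\<close>-th coordinate of \<open>x\<close> is
  also that of the tail left by truncation at \<open>N\<close>, and the tail has small norm.\<close>

lemma norm_pv_act_tendsto: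
  assumes x: "x \<in> mcar M"
  shows "(\<lambda>n. mnorm M (mact M (pv n) x)) \<longlonglongrightarrow> 0"
proof (rule LIMSEQ_I)
  fix e :: real
  assume "0 < e"
  then obtain N where N: "mnorm M (madd M x (msmul M (-1) (mact M (initial N) x))) < e"
    using initial_dense[OF x] by blast
  have "norm (mnorm M (mact M (pv n) x) - 0) < e" if "n \<ge> N" for n
  proof -
    have "mact M (pv n) (madd M x (msmul M (-1) (mact M (initial N) x))) = mact M (pv n) x"
      using x that by (simp add: act_diff pv_act initial_apply)
    then have "mnorm M (mact M (pv n) x) < e"
      using norm_pv_act_le[of "madd M x (msmul M (-1) (mact M (initial N) x))" n] N x by simp
    then show ?thesis
      using x by simp
  qed
  then show "\<exists>N. \<forall>n\<ge>N. norm (mnorm M (mact M (pv n) x) - 0) < e"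
    by blast
qed

end

section \<open>Sufficient conditions for being essential and homogeneous\<close>

lemma in_HI:
  assumes M: "nmodule A nA M" and hom: "homogeneous M"
    and dense: "\<And>x e. x \<in> mcar M \<Longrightarrow> 0 < e \<Longrightarrow>
      \<exists>a\<in>A. \<exists>y\<in>mcar M. mnorm M (madd M x (msmul M (-1) (mact M a y))) < e"
  shows "in_H A nA M"
proof -
  interpret nrm_sp M using M by (simp add: nmodule_iff)
  interpret act_sp A M using M by (simp add: nmodule_iff)
  have "essential A M"
    unfolding essential_def
  proof (intro ballI allI impI)
    fix x and e :: real
    assume "x \<in> mcar M" "0 < e"
    then obtain a y where ay: "a \<in> A" "y \<in> mcar M" "mnorm M (madd M x (msmul M (-1) (mact M a y))) < e"
      using dense by blast
    have "mact M a y = msum M 1 (\<lambda>i. msmul M 1 (mact M a y))"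
      using ay by simp
    then have "mact M a y \<in> lspan M {mact M a y | a y. a \<in> A \<and> y \<in> mcar M}"
      unfolding lspan_def
      by (intro CollectI exI[of _ 1] exI[of _ "\<lambda>_. 1"] exI[of _ "\<lambda>_. mact M a y"]) (use ay in auto)
    with ay show "\<exists>s\<in>lspan M {mact M a y | a y. a \<in> A \<and> y \<in> mcar M}. mnorm M (madd M x (msmul M (-1) s)) < e"
      by blast
  qed
  with M hom show ?thesis
    by (simp add: in_H_def)
qed

text \<open>Such an action is contractive by \<open>norm_coord_le\<close>; as \<open>pv n\<close>
  acts as the identity, essentiality and homogeneity are immediate. In this way lifting problems
  between normed spaces become lifting problems over the algebra.\<close>

lemma (in seq_alg) in_H_single_coordinate:
  assumes M: "nrm_sp M" and act: "\<And>a x. a \<in> A \<Longrightarrow> x \<in> mcar M \<Longrightarrow> mact M a x = msmul M (a n) x"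
  shows "in_H A nA M"
proof -
  interpret nrm_sp M by fact
  have pvn: "mact M (pv n) x = x" if "x \<in> mcar M" for x
    using act[OF pv_in that] that by (simp add: pv_apply)
  show ?thesis
  proof (rule in_HI)
    have "act_sp A M"
      by unfold_locales
        (simp_all add: act smul_add_right smul_add_left smul_smul mult.commute)
    then show "nmodule A nA M"
      by (simp add: nmodule_iff M act norm_smul norm_coord_le mult_right_mono)
    show "homogeneous M"
      unfolding homogeneous_def
    proof (intro ballI impI)
      fix x y
      assume "x \<in> mcar M" "y \<in> mcar M"
        "\<forall>n. mnorm M (mact M (pv n) x) \<le> mnorm M (mact M (pv n) y)"
      then show "mnorm M x \<le> mnorm M y"
        using pvn by (metis (no_types))
    qed
    show "\<exists>a\<in>A. \<exists>y\<in>mcar M. mnorm M (madd M x (msmul M (-1) (mact M a y))) < e"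
      if "x \<in> mcar M" "0 < e" for x e
      using that pvn by (intro bexI[of _ "pv n"] bexI[of _ x]) auto
  qed
qed

text \<open>The common pattern of the two \<open>c_0\<close>-type modules of the finite type
  argument; \<open>q n\<close> turns out to be the norm of the \<open>n\<close>-th coordinate. Its
  convergence to zero has two uses: it makes the supremum finite, and it makes truncations
  dense.\<close>

lemma (in seq_alg) in_H_sup_norm:
  fixes q :: "nat \<Rightarrow> 'x \<Rightarrow> real"
  assumes "act_sp A M"
    and q_add: "\<And>n x y. x \<in> mcar M \<Longrightarrow> y \<in> mcar M \<Longrightarrow> q n (madd M x y) \<le> q n x + q n y"
    and q_smul: "\<And>n c x. x \<in> mcar M \<Longrightarrow> q n (msmul M c x) = cmod c * q n x"
    and q_act: "\<And>n a x. a \<in> A \<Longrightarrow> x \<in> mcar M \<Longrightarrow> q n (mact M a x) = cmod (a n) * q n x"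
    and q_lim: "\<And>x. x \<in> mcar M \<Longrightarrow> (\<lambda>n. q n x) \<longlonglongrightarrow> 0"
    and q_zero: "\<And>x. x \<in> mcar M \<Longrightarrow> (\<And>n. q n x = 0) \<Longrightarrow> x = mzero M"
    and norm: "\<And>x. x \<in> mcar M \<Longrightarrow> mnorm M x = (SUP n. q n x)"
  shows "in_H A nA M"
    and "\<And>x n. x \<in> mcar M \<Longrightarrow> q n x \<le> mnorm M x"
    and "\<And>x C. x \<in> mcar M \<Longrightarrow> (\<And>n. q n x \<le> C) \<Longrightarrow> mnorm M x \<le> C"
    and "\<And>x n. x \<in> mcar M \<Longrightarrow> mnorm M (mact M (pv n) x) = q n x"
proof -
  interpret act_sp A M by fact
  interpret seq_act A nA M by unfold_locales
  have q0: "q n (mzero M) = 0" for n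
    using q_smul[of "mzero M" n 0] by simp
  \<comment> \<open>Nonnegativity is a consequence of subadditivity: the value at zero is at most
    the sum of the equal values at \<open>x\<close> and at its negative.\<close>
  have q_nonneg: "0 \<le> q n x" if "x \<in> mcar M" for n x
    using q_add[of x "msmul M (-1) x" n] q_smul[of x n "-1"] that q0 by simp
  have bdd: "bdd_above (range (\<lambda>n. q n x))" if "x \<in> mcar M" for x
  proof -
    obtain K where "\<And>n. norm (q n x) \<le> K"
      using convergent_imp_Bseq[OF convergentI[OF q_lim[OF \<open>x \<in> mcar M\<close>]]] by (metis BseqE)
    then show ?thesis
      by (intro bdd_aboveI[of _ K]) (auto dest: abs_le_D1)
  qed
  show le: "q n x \<le> mnorm M x" if "x \<in> mcar M" for x n
    unfolding norm[OF that] by (rule cSUP_upper) (use bdd that in auto)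
  show least: "mnorm M x \<le> C" if "x \<in> mcar M" "\<And>n. q n x \<le> C" for x C
    unfolding norm[OF that(1)] by (rule cSUP_least) (use that in auto)
  have nonneg: "0 \<le> mnorm M x" if "x \<in> mcar M" for x
    using le[OF that, of 0] q_nonneg[OF that, of 0] by linarith
  have q_pv: "q m (mact M (pv n) x) = (if m = n then q n x else 0)" if "x \<in> mcar M" for m n x
    using that by (simp add: q_act pv_apply)
  show pv: "mnorm M (mact M (pv n) x) = q n x" if "x \<in> mcar M" for x n
  proof (rule antisym)
    show "mnorm M (mact M (pv n) x) \<le> q n x"
      by (rule least) (use that q_nonneg in \<open>auto simp: q_pv\<close>)
    show "q n x \<le> mnorm M (mact M (pv n) x)"
      using le[of "mact M (pv n) x" n] that by (simp add: q_pv)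
  qed
  have smul_le: "mnorm M (msmul M c x) \<le> cmod c * mnorm M x" if "x \<in> mcar M" for c x
    by (rule least) (use that le in \<open>auto simp: q_smul mult_left_mono\<close>)
  interpret nrm_sp M
  proof unfold_locales
    show "mnorm M x = 0 \<longleftrightarrow> x = mzero M" if "x \<in> mcar M" for x
    proof
      assume "mnorm M x = 0"
      then show "x = mzero M"
        using that le[OF that] q_nonneg[OF that] by (intro q_zero) (auto intro: antisym)
    next
      assume "x = mzero M"
      then show "mnorm M x = 0"
        using least[of x 0] nonneg[of x] q0 by simp
    qed
    show "mnorm M (msmul M c x) = cmod c * mnorm M x" if "x \<in> mcar M" for c x
    proof (cases "c = 0")
      case True
      then show ?thesis
        using that least[of "mzero M" 0] nonneg[of "mzero M"] q0 by simp
    next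
      case False
      \<comment> \<open>The upper estimate, applied to \<open>inverse c\<close>, gives the lower
        one.\<close>
      have "mnorm M x \<le> cmod (inverse c) * mnorm M (msmul M c x)"
        using smul_le[of "msmul M c x" "inverse c"] that False by (simp add: smul_smul)
      then have "cmod c * mnorm M x \<le> mnorm M (msmul M c x)"
        using False by (simp add: norm_divide norm_inverse field_simps)
      then show ?thesis
        using smul_le[OF that, of c] by linarith
    qed
    show "mnorm M (madd M x y) \<le> mnorm M x + mnorm M y" if "x \<in> mcar M" "y \<in> mcar M" for x y
      by (rule least) (use that le in \<open>auto intro!: order_trans[OF q_add] add_mono\<close>)
  qed (use nonneg in auto)
  show "in_H A nA M"
  proof (rule in_HI)
    have "mnorm M (mact M a x) \<le> nA a * mnorm M x" if "a \<in> A" "x \<in> mcar M" for a x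
      by (rule least)
        (use that le q_nonneg nonneg alg_norm_nonneg in \<open>auto simp: q_act norm_coord_le intro!: mult_mono\<close>)
    then show "nmodule A nA M"
      by (simp add: nmodule_iff nrm_sp_axioms act_sp_axioms)
    show "homogeneous M"
      unfolding homogeneous_def
    proof (intro ballI impI)
      fix x y
      assume "x \<in> mcar M" "y \<in> mcar M"
        "\<forall>n. mnorm M (mact M (pv n) x) \<le> mnorm M (mact M (pv n) y)"
      then show "mnorm M x \<le> mnorm M y"
        using le[of y] by (intro least) (auto simp: pv intro: order_trans)
    qed
  next
    fix x and e :: real
    assume x: "x \<in> mcar M" and e: "0 < e"
    then obtain N where N: "\<And>n. n \<ge> N \<Longrightarrow> \<bar>q n x\<bar> < e / 2"
      using LIMSEQ_D[OF q_lim[OF x], of "e / 2"] by auto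
    let ?z = "madd M x (msmul M (-1) (mact M (initial N) x))"
    \<comment> \<open>Below \<open>N\<close> the coordinates of \<open>?z\<close> vanish, and from
      \<open>N\<close> on they are those of \<open>x\<close>. The bound is \<open>e / 2\<close>
      because a supremum preserves only weak inequalities.\<close>
    have "q n ?z \<le> e / 2" for n
    proof (cases "n < N")
      case True
      have "q n ?z = q n (mact M (pv n) ?z)"
        using x by (simp add: q_pv)
      also have "mact M (pv n) ?z = mzero M"
        using x True by (simp add: act_diff pv_act initial_apply)
      finally show ?thesis
        using e q0 by simp
    next
      case False
      then show ?thesis
        using q_add[of x "msmul M (-1) (mact M (initial N) x)" n] N[of n] x
        by (simp add: q_smul q_act initial_apply)
    qed
    then have "mnorm M ?z \<le> e / 2"
      using x by (intro least) auto
    then show "\<exists>a\<in>A. \<exists>y\<in>mcar M. mnorm M (madd M x (msmul M (-1) (mact M a y))) < e"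
      using x e by (intro bexI[of _ "initial N"] bexI[of _ x]) auto
  qed
qed

section \<open>Transport along injections\<close>

text \<open>An isometric copy with carrier in another type. Projectivity speaks of modules in
  prescribed types, and each constructed test module has to be copied there. Only the values on the
  image of \<open>i\<close> matter.\<close>

definition transport :: "('x \<Rightarrow> 'y) \<Rightarrow> 'x nmod \<Rightarrow> 'y nmod" where
  "transport i M = \<lparr> mcar = i ` mcar M, mzero = i (mzero M),
     madd = (\<lambda>x y. i (madd M (the_inv i x) (the_inv i y))),
     msmul = (\<lambda>c x. i (msmul M c (the_inv i x))),
     mact = (\<lambda>a x. i (mact M a (the_inv i x))),
     mnorm = (\<lambda>x. mnorm M (the_inv i x)) \<rparr>"

context
  fixes i :: "'x \<Rightarrow> 'y"
  assumes inj: "inj i"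
begin

lemma transport_simps [simp]:
  "mcar (transport i M) = i ` mcar M"
  "mzero (transport i M) = i (mzero M)"
  "madd (transport i M) (i x) (i y) = i (madd M x y)"
  "msmul (transport i M) c (i x) = i (msmul M c x)"
  "mact (transport i M) a (i x) = i (mact M a x)"
  "mnorm (transport i M) (i x) = mnorm M x"
  by (simp_all add: transport_def the_inv_f_f[OF inj])

lemma nrm_sp_transport:
  assumes "nrm_sp M"
  shows "nrm_sp (transport i M)"
proof -
  interpret nrm_sp M by fact
  show ?thesis
    by unfold_locales
      (auto simp: inj_eq[OF inj] add_assoc smul_smul smul_add_left smul_add_right
        norm_eq_0 norm_smul norm_triangle intro: add_comm)
qed

lemma in_H_transport:
  assumes "seq_algebra A nA" "in_H A nA M"
  shows "in_H A nA (transport i M)"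
proof -
  interpret H_mod A nA M
    using assms by (simp add: H_mod_def H_mod_axioms_def seq_alg_def)
  interpret T: nrm_sp "transport i M"
    by (rule nrm_sp_transport[OF nrm_sp_axioms])
  show ?thesis
  proof (rule in_HI)
    have "act_sp A (transport i M)"
      by unfold_locales
        (auto simp: act_add act_smul add_act smul_act mult_act)
    then show "nmodule A nA (transport i M)"
      by (auto simp: nmodule_iff T.nrm_sp_axioms norm_act_le)
    show "homogeneous (transport i M)"
      unfolding homogeneous_def by (auto intro: norm_mono)
    show "\<exists>a\<in>A. \<exists>y\<in>mcar (transport i M).
        mnorm (transport i M) (madd (transport i M) x (msmul (transport i M) (-1) (mact (transport i M) a y))) < e"
      if x: "x \<in> mcar (transport i M)" and e: "0 < e" for x e
    proof -
      obtain z where z: "z \<in> mcar M" "x = i z"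
        using x by auto
      then obtain N where "mnorm M (madd M z (msmul M (-1) (mact M (initial N) z))) < e"
        using initial_dense[OF z(1) e] by blast
      with z show ?thesis
        by (intro bexI[of _ "initial N"] bexI[of _ x]) auto
    qed
  qed
qed

lemma lin_bdd_into_transport: "lin_bdd P M f \<Longrightarrow> lin_bdd P (transport i M) (\<lambda>p. i (f p))"
  unfolding lin_bdd_def by simp

lemma opnorm_into_transport: "opnorm P (transport i M) (\<lambda>p. i (f p)) = opnorm P M f"
  by (simp add: opnorm_def)

lemma lin_bdd_from_transport:
  assumes "lin_bdd M N f"
  shows "lin_bdd (transport i M) N (\<lambda>x. f (the_inv i x))"
  using assms unfolding lin_bdd_def by (auto simp: the_inv_f_f[OF inj])

lemma opnorm_from_transport: "opnorm (transport i M) N (\<lambda>x. f (the_inv i x)) = opnorm M N f"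
  by (simp add: opnorm_def the_inv_f_f[OF inj])

lemma lin_bdd_out_of_transport:
  assumes f: "lin_bdd P (transport i M) f"
  shows "lin_bdd P M (\<lambda>p. the_inv i (f p))" "opnorm P M (\<lambda>p. the_inv i (f p)) = opnorm P (transport i M) f"
    "\<And>p. p \<in> mcar P \<Longrightarrow> i (the_inv i (f p)) = f p"
proof -
  have in_M: "the_inv i (f p) \<in> mcar M" "i (the_inv i (f p)) = f p" if "p \<in> mcar P" for p
    using f that the_inv_f_f[OF inj] unfolding lin_bdd_def by auto
  then have norm: "mnorm (transport i M) (f p) = mnorm M (the_inv i (f p))" if "p \<in> mcar P" for p
    using that by (metis transport_simps(6))
  show "\<And>p. p \<in> mcar P \<Longrightarrow> i (the_inv i (f p)) = f p"
    by (rule in_M)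
  show "opnorm P M (\<lambda>p. the_inv i (f p)) = opnorm P (transport i M) f"
    by (simp add: opnorm_def norm)
  have "the_inv i (f (madd P x y)) = madd M (the_inv i (f x)) (the_inv i (f y))"
    if "x \<in> mcar P" "y \<in> mcar P" for x y
    using f that in_M unfolding lin_bdd_def by (metis the_inv_f_f[OF inj] transport_simps(3))
  moreover have "the_inv i (f (msmul P c x)) = msmul M c (the_inv i (f x))" if "x \<in> mcar P" for c x
    using f that in_M unfolding lin_bdd_def by (metis the_inv_f_f[OF inj] transport_simps(4))
  moreover obtain C where "\<forall>x\<in>mcar P. mnorm (transport i M) (f x) \<le> C * mnorm P x"
    using f unfolding lin_bdd_def by blast
  ultimately show "lin_bdd P M (\<lambda>p. the_inv i (f p))"
    unfolding lin_bdd_def using in_M norm by (intro conjI ballI allI exI[of _ C]) auto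
qed

lemma morph_out_of_transport:
  assumes f: "morph A P (transport i M) f"
  shows "morph A P M (\<lambda>p. the_inv i (f p))"
proof -
  have lin: "lin_bdd P (transport i M) f"
    using f by (simp add: morph_def)
  have "the_inv i (f (mact P a x)) = mact M a (the_inv i (f x))" if "a \<in> A" "x \<in> mcar P" for a x
    using f that lin_bdd_out_of_transport(3)[OF lin] unfolding morph_def
    by (metis the_inv_f_f[OF inj] transport_simps(5))
  then show ?thesis
    using lin_bdd_out_of_transport(1)[OF lin] by (simp add: morph_def)
qed

end

lemma transport_map:
  assumes i: "inj i" and j: "inj j"
  shows "lin_bdd M N f \<Longrightarrow> lin_bdd (transport i M) (transport j N) (\<lambda>x. j (f (the_inv i x)))"
    and "morph A M N f \<Longrightarrow> morph A (transport i M) (transport j N) (\<lambda>x. j (f (the_inv i x)))"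
    and "coisometric M N f \<Longrightarrow> coisometric (transport i M) (transport j N) (\<lambda>x. j (f (the_inv i x)))"
proof -
  show lin: "lin_bdd (transport i M) (transport j N) (\<lambda>x. j (f (the_inv i x)))" if "lin_bdd M N f"
    using lin_bdd_from_transport[OF i lin_bdd_into_transport[OF j that]] .
  show "morph A (transport i M) (transport j N) (\<lambda>x. j (f (the_inv i x)))" if "morph A M N f"
    using that lin unfolding morph_def by (auto simp: i j the_inv_f_f[OF i])
  show "coisometric (transport i M) (transport j N) (\<lambda>x. j (f (the_inv i x)))" if "coisometric M N f"
    using that opnorm_from_transport[OF i, of M "transport j N" "\<lambda>x. j (f x)"]
      opnorm_into_transport[OF j, of M N f]
    unfolding coisometric_def by (simp add: i j the_inv_f_f[OF i] inj_eq[OF j])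
qed

text \<open>A lifting problem is copied along \<open>i\<close> and \<open>j\<close>, solved there,
  and the solution is pulled back; all norms are preserved. Projectivity thus descends to every type
  that embeds into the given one.\<close>

lemma ext_proj_Nor_transport:
  fixes i :: "'u \<Rightarrow> 'y" and j :: "'v \<Rightarrow> 'z"
  assumes proj: "ext_proj_Nor P TYPE('y) TYPE('z)" and i: "inj i" and j: "inj j"
  shows "ext_proj_Nor P TYPE('u) TYPE('v)"
  unfolding ext_proj_Nor_def
proof (intro allI impI, elim conjE)
  fix Y :: "'u nmod" and X :: "'v nmod" and t phi and e :: real
  assume *: "normed_sp Y" "normed_sp X" "lin_bdd Y X t" "coisometric Y X t" "lin_bdd P X phi" "0 < e"
  have "\<exists>psi. lin_bdd P (transport i Y) psi \<and> (\<forall>p\<in>mcar P. j (t (the_inv i (psi p))) = j (phi p)) \<and>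
      opnorm P (transport i Y) psi < opnorm P (transport j X) (\<lambda>p. j (phi p)) + e"
    using proj[unfolded ext_proj_Nor_def, rule_format,
        of "transport i Y" "transport j X" "\<lambda>x. j (t (the_inv i x))" "\<lambda>p. j (phi p)" e]
      nrm_sp_transport[OF i, of Y] nrm_sp_transport[OF j, of X] transport_map[OF i j]
      lin_bdd_into_transport[OF j *(5)] *
    by (simp add: normed_sp_iff)
  then obtain psi where psi: "lin_bdd P (transport i Y) psi"
    "\<And>p. p \<in> mcar P \<Longrightarrow> t (the_inv i (psi p)) = phi p"
    "opnorm P (transport i Y) psi < opnorm P X phi + e"
    by (auto simp: inj_eq[OF j] opnorm_into_transport[OF j])
  then show "\<exists>psi. lin_bdd P Y psi \<and> (\<forall>p\<in>mcar P. t (psi p) = phi p) \<and>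
      opnorm P Y psi < opnorm P X phi + e"
    using lin_bdd_out_of_transport[OF i psi(1)] by (intro exI[of _ "\<lambda>p. the_inv i (psi p)"]) auto
qed

lemma ext_proj_H_transport:
  fixes i :: "'u \<Rightarrow> 'y" and j :: "'v \<Rightarrow> 'z"
  assumes proj: "ext_proj_H A nA P TYPE('y) TYPE('z)" and i: "inj i" and j: "inj j"
    and A: "seq_algebra A nA"
  shows "ext_proj_H A nA P TYPE('u) TYPE('v)"
  unfolding ext_proj_H_def
proof (intro allI impI, elim conjE)
  fix Y :: "'u nmod" and X :: "'v nmod" and t phi and e :: real
  assume *: "in_H A nA Y" "in_H A nA X" "morph A Y X t" "coisometric Y X t" "morph A P X phi" "0 < e"
  have "morph A P (transport j X) (\<lambda>p. j (phi p))"
    using *(5) lin_bdd_into_transport[OF j, of P X phi] by (simp add: morph_def j)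
  then have "\<exists>psi. morph A P (transport i Y) psi \<and> (\<forall>p\<in>mcar P. j (t (the_inv i (psi p))) = j (phi p)) \<and>
      opnorm P (transport i Y) psi < opnorm P (transport j X) (\<lambda>p. j (phi p)) + e"
    using proj[unfolded ext_proj_H_def, rule_format,
        of "transport i Y" "transport j X" "\<lambda>x. j (t (the_inv i x))" "\<lambda>p. j (phi p)" e]
      in_H_transport[OF i A, of Y] in_H_transport[OF j A, of X] transport_map[OF i j] *
    by simp
  then obtain psi where psi: "morph A P (transport i Y) psi"
    "\<And>p. p \<in> mcar P \<Longrightarrow> t (the_inv i (psi p)) = phi p"
    "opnorm P (transport i Y) psi < opnorm P X phi + e"
    by (auto simp: inj_eq[OF j] opnorm_into_transport[OF j])
  moreover have "lin_bdd P (transport i Y) psi"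
    using psi(1) by (simp add: morph_def)
  ultimately show "\<exists>psi. morph A P Y psi \<and> (\<forall>p\<in>mcar P. t (psi p) = phi p) \<and>
      opnorm P Y psi < opnorm P X phi + e"
    using lin_bdd_out_of_transport(2)[OF i, of P Y psi] morph_out_of_transport[OF i psi(1)]
    by (intro exI[of _ "\<lambda>p. the_inv i (psi p)"]) auto
qed

lemma top_proj_H_transport:
  fixes i :: "'u \<Rightarrow> 'y" and j :: "'v \<Rightarrow> 'z"
  assumes proj: "top_proj_H A nA P TYPE('y) TYPE('z)" and i: "inj i" and j: "inj j"
    and A: "seq_algebra A nA"
  shows "top_proj_H A nA P TYPE('u) TYPE('v)"
  unfolding top_proj_H_def
proof (intro allI impI, elim conjE)
  fix Y :: "'u nmod" and X :: "'v nmod" and t phi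
  assume *: "in_H A nA Y" "in_H A nA X" "morph A Y X t" "coisometric Y X t" "morph A P X phi"
  have "morph A P (transport j X) (\<lambda>p. j (phi p))"
    using *(5) lin_bdd_into_transport[OF j, of P X phi] by (simp add: morph_def j)
  then have "\<exists>psi. morph A P (transport i Y) psi \<and> (\<forall>p\<in>mcar P. j (t (the_inv i (psi p))) = j (phi p))"
    using proj[unfolded top_proj_H_def, rule_format,
        of "transport i Y" "transport j X" "\<lambda>x. j (t (the_inv i x))" "\<lambda>p. j (phi p)"]
      in_H_transport[OF i A, of Y] in_H_transport[OF j A, of X] transport_map[OF i j] *
    by simp
  then obtain psi where psi: "morph A P (transport i Y) psi"
    "\<And>p. p \<in> mcar P \<Longrightarrow> t (the_inv i (psi p)) = phi p"
    by (auto simp: inj_eq[OF j])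
  then show "\<exists>psi. morph A P Y psi \<and> (\<forall>p\<in>mcar P. t (psi p) = phi p)"
    using morph_out_of_transport[OF i psi(1)] by (intro exI[of _ "\<lambda>p. the_inv i (psi p)"]) auto
qed

section \<open>The spaces of finitely supported functions\<close>

definition delta :: "'l \<Rightarrow> 'l \<Rightarrow> complex" where
  "delta j = (\<lambda>i. if i = j then 1 else 0)"

text \<open>The target of the evaluations of finitely supported functions, to which
  \<open>fsum_hom\<close> is applied.\<close>

definition scalars :: "complex nmod" where
  "scalars = \<lparr> mcar = UNIV, mzero = 0, madd = (+), msmul = (*), mact = (\<lambda>_ x. x), mnorm = cmod \<rparr>"

lemma vec_sp_scalars: "vec_sp scalars"
  by unfold_locales (auto simp: scalars_def algebra_simps)

lemma l1z_simps [simp]: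
  "mcar (l1z L) = {f. finite {i. f i \<noteq> 0} \<and> {i. f i \<noteq> 0} \<subseteq> L}"
  "mzero (l1z L) = (\<lambda>_. 0)"
  "madd (l1z L) f g = (\<lambda>i. f i + g i)"
  "msmul (l1z L) c f = (\<lambda>i. c * f i)"
  by (simp_all add: l1z_def)

lemma norm_l1z_eq:
  assumes "finite S" "{i. f i \<noteq> 0} \<subseteq> S"
  shows "mnorm (l1z L) f = (\<Sum>i\<in>S. cmod (f i))"
  unfolding l1z_def by (simp, rule sum.mono_neutral_left) (use assms in auto)

lemma support_add_finite:
  fixes f g :: "'l \<Rightarrow> complex"
  assumes "finite {i. f i \<noteq> 0}" "finite {i. g i \<noteq> 0}"
  shows "finite {i. f i + g i \<noteq> 0}"
  by (rule finite_subset[of _ "{i. f i \<noteq> 0} \<union> {i. g i \<noteq> 0}"]) (use assms in auto)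

lemma nrm_sp_l1z: "nrm_sp (l1z (L :: 'l set))"
proof
  fix f g :: "'l \<Rightarrow> complex" and c :: complex
  assume f: "f \<in> mcar (l1z L)"
  show "msmul (l1z L) c f \<in> mcar (l1z L)"
    using f by (auto elim: finite_subset[rotated])
  show "0 \<le> mnorm (l1z L) f"
    by (simp add: l1z_def sum_nonneg)
  show "mnorm (l1z L) f = 0 \<longleftrightarrow> f = mzero (l1z L)"
    using f by (auto simp: l1z_def sum_nonneg_eq_0_iff)
  have "mnorm (l1z L) (msmul (l1z L) c f) = (\<Sum>i\<in>{i. f i \<noteq> 0}. cmod (c * f i))"
    using f by (subst norm_l1z_eq[of "{i. f i \<noteq> 0}"]) auto
  then show "mnorm (l1z L) (msmul (l1z L) c f) = cmod c * mnorm (l1z L) f"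
    by (simp add: l1z_def norm_mult sum_distrib_left)
  assume g: "g \<in> mcar (l1z L)"
  show "madd (l1z L) f g \<in> mcar (l1z L)"
  proof -
    have "i \<in> L" if "f i + g i \<noteq> 0" for i
      using f g that by (cases "f i = 0") auto
    then show ?thesis
      using f g by (auto intro: support_add_finite)
  qed
  let ?S = "{i. f i \<noteq> 0} \<union> {i. g i \<noteq> 0}"
  have "mnorm (l1z L) (madd (l1z L) f g) = (\<Sum>i\<in>?S. cmod (f i + g i))"
    using f g by (subst norm_l1z_eq[of ?S]) auto
  also have "\<dots> \<le> (\<Sum>i\<in>?S. cmod (f i)) + (\<Sum>i\<in>?S. cmod (g i))"
    by (simp add: norm_triangle_ineq sum_mono flip: sum.distrib)
  also have "\<dots> = mnorm (l1z L) f + mnorm (l1z L) g"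
    using f g norm_l1z_eq[of ?S f] norm_l1z_eq[of ?S g] by auto
  finally show "mnorm (l1z L) (madd (l1z L) f g) \<le> mnorm (l1z L) f + mnorm (l1z L) g" .
qed (auto simp: algebra_simps)

lemma smul_delta_in_l1z: "j \<in> L \<Longrightarrow> (\<lambda>i. c * delta j i) \<in> mcar (l1z L)"
  by (auto simp: delta_def)

lemma norm_smul_delta: "mnorm (l1z L) (\<lambda>i. c * delta j i) = cmod c"
  by (subst norm_l1z_eq[of "{j}"]) (auto simp: delta_def)

text \<open>Evaluation at \<open>j\<close> is additive, so it passes inside the sum and leaves a
  single term. The default zero outside \<open>L\<close> keeps the whole family in the carrier,
  since \<open>fsum\<close> ranges over all indices of the type.\<close>

lemma l1z_expand:
  assumes f: "f \<in> mcar (l1z L)"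
  shows "fsum (l1z L) (\<lambda>i. msmul (l1z L) (f i) (if i \<in> L then delta i else (\<lambda>_. 0))) = f"
    (is "fsum _ ?g = f")
proof
  fix j
  interpret nrm_sp "l1z L" by (rule nrm_sp_l1z)
  interpret S: vec_sp scalars by (rule vec_sp_scalars)
  have g: "?g i = (\<lambda>j. if i = j then f j else 0)" for i
    using f by (cases "i \<in> L") (auto simp: delta_def fun_eq_iff)
  have "(\<lambda>h. h j) (fsum (l1z L) ?g) = fsum scalars (\<lambda>i. (\<lambda>h. h j) (?g i))"
  proof (rule fsum_hom[OF vec_sp_axioms vec_sp_scalars])
    show "finite {i. ?g i \<noteq> mzero (l1z L)}"
      by (rule finite_subset[of _ "{i. f i \<noteq> 0}"]) (use f in auto)
    show "?g i \<in> mcar (l1z L)" for i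
      unfolding g using f by auto
  qed (auto simp: scalars_def)
  also have "\<dots> = f j"
    unfolding g using S.fsum_single[of "f j" j] by (simp add: scalars_def cong: if_cong)
  finally show "fsum (l1z L) ?g j = f j"
    by simp
qed

text \<open>The linear map prescribed by \<open>v\<close> on the unit vectors. It is bounded as soon
  as \<open>v\<close> is, with the same constant: this freeness of the l_1-norm is the source of all
  liftings.\<close>

definition lin_ext :: "'x nmod \<Rightarrow> ('l \<Rightarrow> 'x) \<Rightarrow> ('l \<Rightarrow> complex) \<Rightarrow> 'x" where
  "lin_ext N v f = fsum N (\<lambda>i. msmul N (f i) (v i))"

context nrm_sp
begin

lemma finite_smul_support:
  assumes "finite {i. f i \<noteq> 0}" "\<And>i. v i \<in> mcar M"
  shows "finite {i. msmul M (f i) (v i) \<noteq> mzero M}"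
  by (rule finite_subset[of _ "{i. f i \<noteq> 0}"]) (use assms in auto)

lemma norm_lin_ext_le:
  assumes f: "f \<in> mcar (l1z L)" and v: "\<And>i. v i \<in> mcar M"
    and C: "\<And>i. i \<in> L \<Longrightarrow> mnorm M (v i) \<le> C"
  shows "mnorm M (lin_ext M v f) \<le> C * mnorm (l1z L) f"
proof -
  have "mnorm M (lin_ext M v f) \<le> (\<Sum>i\<in>{i. f i \<noteq> 0}. mnorm M (msmul M (f i) (v i)))"
    unfolding lin_ext_def by (rule norm_fsum_le) (use f v in auto)
  also have "\<dots> \<le> (\<Sum>i\<in>{i. f i \<noteq> 0}. C * cmod (f i))"
    using f v C by (intro sum_mono) (auto simp: norm_smul mult.commute[of C] intro!: mult_left_mono)
  finally show ?thesis
    by (simp add: l1z_def sum_distrib_left)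
qed

lemma lin_bdd_lin_ext:
  assumes v: "\<And>i. v i \<in> mcar M" and C: "\<And>i. i \<in> L \<Longrightarrow> mnorm M (v i) \<le> C"
  shows "lin_bdd (l1z L) M (lin_ext M v)"
  unfolding lin_bdd_def
proof (intro conjI ballI allI exI[of _ C])
  fix f g :: "'b \<Rightarrow> complex" and c
  assume f: "f \<in> mcar (l1z L)"
  show "lin_ext M v f \<in> mcar M"
    using v by (simp add: lin_ext_def)
  have "lin_ext M v (msmul (l1z L) c f) = fsum M (\<lambda>i. msmul M c (msmul M (f i) (v i)))"
    using v by (simp add: lin_ext_def smul_smul)
  also have "\<dots> = msmul M c (lin_ext M v f)"
    unfolding lin_ext_def
    by (rule fsum_hom[OF vec_sp_axioms vec_sp_axioms, of "msmul M c", symmetric])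
      (use f v in \<open>auto simp: smul_add_right intro!: finite_smul_support\<close>)
  finally show "lin_ext M v (msmul (l1z L) c f) = msmul M c (lin_ext M v f)" .
  show "mnorm M (lin_ext M v f) \<le> C * mnorm (l1z L) f"
    by (rule norm_lin_ext_le[OF f v C])
  assume g: "g \<in> mcar (l1z L)"
  have "lin_ext M v (madd (l1z L) f g) = fsum M (\<lambda>i. madd M (msmul M (f i) (v i)) (msmul M (g i) (v i)))"
    using v by (simp add: lin_ext_def smul_add_left)
  also have "\<dots> = madd M (lin_ext M v f) (lin_ext M v g)"
    unfolding lin_ext_def
    by (rule fsum_add) (use f g v in \<open>auto intro!: finite_smul_support\<close>)
  finally show "lin_ext M v (madd (l1z L) f g) = madd M (lin_ext M v f) (lin_ext M v g)" .
qed

lemma lin_ext_smul_delta: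
  assumes "\<And>i. v i \<in> mcar M"
  shows "lin_ext M v (\<lambda>i. c * delta j i) = msmul M c (v j)"
proof -
  have "(\<lambda>i. msmul M (c * delta j i) (v i)) = (\<lambda>i. if i = j then msmul M c (v j) else mzero M)"
    using assms by (auto simp: delta_def)
  then show ?thesis
    using fsum_single[of "msmul M c (v j)" j] assms by (simp add: lin_ext_def)
qed

end

lemma lin_bdd_lin_ext_comp:
  assumes M: "vec_sp M" and N: "vec_sp N" and g: "lin_bdd M N g"
    and v: "\<And>i. v i \<in> mcar M" and f: "finite {i. f i \<noteq> 0}"
  shows "g (lin_ext M v f) = lin_ext N (\<lambda>i. g (v i)) f"
proof -
  interpret M: vec_sp M by fact
  have "g (fsum M (\<lambda>i. msmul M (f i) (v i))) = fsum N (\<lambda>i. g (msmul M (f i) (v i)))"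
  proof (rule fsum_hom[OF M N])
    show "finite {i. msmul M (f i) (v i) \<noteq> mzero M}"
      by (rule finite_subset[OF _ f]) (use v in auto)
  qed (use g v in \<open>auto simp: lin_bdd_def\<close>)
  then show ?thesis
    using g v by (simp add: lin_ext_def lin_bdd_def)
qed

lemma lin_bdd_l1z_eq:
  assumes N: "vec_sp N" and g: "lin_bdd (l1z L) N g" and f: "f \<in> mcar (l1z L)"
  shows "g f = lin_ext N (\<lambda>i. g (if i \<in> L then delta i else (\<lambda>_. 0))) f"
proof -
  interpret nrm_sp "l1z L" by (rule nrm_sp_l1z)
  have "lin_ext (l1z L) (\<lambda>i. if i \<in> L then delta i else (\<lambda>_. 0)) f = f"
    unfolding lin_ext_def by (rule l1z_expand[OF f])
  then show ?thesis
    using lin_bdd_lin_ext_comp[OF vec_sp_axioms N g, of "\<lambda>i. if i \<in> L then delta i else (\<lambda>_. 0)" f] f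
    by (simp add: delta_def)
qed

section \<open>Near-retracts of \<open>l1z\<close> are extremely projective among normed
  spaces\<close>

lemma small_perturbation:
  fixes f :: "real \<Rightarrow> real"
  assumes "isCont f 0" "f 0 < c"
  shows "\<exists>d>0. f d < c"
proof -
  have "\<forall>\<^sub>F x in at 0. f x < c"
    using assms by (auto simp: isCont_def intro: order_tendstoD)
  then obtain d where d: "0 < d" "\<And>x. x \<noteq> 0 \<Longrightarrow> dist x 0 < d \<Longrightarrow> f x < c"
    unfolding eventually_at by auto
  have "f (d / 2) < c"
    using d(1) by (intro d(2)) auto
  then show ?thesis
    using d(1) half_gt_zero by blast
qed

text \<open>Along the near-retraction each unit vector has an image in \<open>P\<close>; its value
  under \<open>phi\<close> is lifted through \<open>t\<close>. The choices are extended linearly to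
  \<open>l1z L\<close> and composed with a right inverse of small norm. The types of
  \<open>Y\<close> and \<open>X\<close> are arbitrary here.\<close>

lemma near_retract_imp_ext_proj_Nor:
  assumes P: "nrm_sp P" and retract: "near_retract P (l1z L)"
  shows "ext_proj_Nor P TYPE('y) TYPE('z)"
  unfolding ext_proj_Nor_def
proof (intro allI impI, elim conjE)
  fix Y :: "'y nmod" and X :: "'z nmod" and t phi and e :: real
  assume "normed_sp Y" "normed_sp X" and t: "lin_bdd Y X t" "coisometric Y X t"
    and phi: "lin_bdd P X phi" and e: "0 < e"
  then interpret Y: nrm_sp Y + X: nrm_sp X
    by (simp_all add: normed_sp_iff)
  interpret P: nrm_sp P by fact
  interpret l: nrm_sp "l1z L" by (rule nrm_sp_l1z)
  obtain s where s: "lin_bdd (l1z L) P s" "opnorm (l1z L) P s \<le> 1"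
    and r: "\<And>d. 0 < d \<Longrightarrow> \<exists>r. lin_bdd P (l1z L) r \<and> (\<forall>x\<in>mcar P. s (r x) = x) \<and> opnorm P (l1z L) r < 1 + d"
    using retract unfolding near_retract_def by blast
  let ?K = "opnorm P X phi"
  have K: "0 \<le> ?K" by (rule opnorm_ge0[OF phi P])
  \<comment> \<open>The first factor bounds the lifts of the unit vectors, the second one the right
    inverse \<open>r\<close>.\<close>
  have "\<exists>d>0. (?K + d) * (1 + d) < ?K + e"
    by (rule small_perturbation) (use e in auto)
  then obtain d where d: "0 < d" "(?K + d) * (1 + d) < ?K + e"
    by blast
  obtain r where r: "lin_bdd P (l1z L) r" "\<And>x. x \<in> mcar P \<Longrightarrow> s (r x) = x" "opnorm P (l1z L) r < 1 + d"
    using r[OF d(1)] by blast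
  let ?b = "\<lambda>i. if i \<in> L then delta i else (\<lambda>_. 0)"
  have b: "?b i \<in> mcar (l1z L)" for i
    by (auto simp: delta_def)
  have norm_b: "mnorm (l1z L) (?b i) \<le> 1" for i
    using norm_smul_delta[of L 1 i] l.norm_zero by auto
  have sb: "s (?b i) \<in> mcar P" for i
    using s(1) b by (simp only: lin_bdd_def)
  have "mnorm P (s (?b i)) \<le> 1" for i
    using norm_le_of_opnorm_le[OF s(1) nrm_sp_l1z s(2) b[of i]] norm_b[of i] by simp
  then have "mnorm X (phi (s (?b i))) \<le> ?K" for i
    using norm_le_opnorm[OF phi P sb[of i]] K mult_left_mono[of "mnorm P (s (?b i))" 1 ?K] by fastforce
  moreover have pb: "phi (s (?b i)) \<in> mcar X" for i
    using phi sb by (simp only: lin_bdd_def)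
  ultimately have "\<exists>y\<in>mcar Y. t y = phi (s (?b i)) \<and> mnorm Y y \<le> ?K + d" for i
    using t(2)[unfolded coisometric_def] d(1) by (meson add_right_mono less_imp_le order_trans)
  then obtain y where y: "\<And>i. y i \<in> mcar Y" "\<And>i. t (y i) = phi (s (?b i))" "\<And>i. mnorm Y (y i) \<le> ?K + d"
    by metis
  define psi where "psi p = lin_ext Y y (r p)" for p
  have rp: "r p \<in> mcar (l1z L)" if "p \<in> mcar P" for p
    using r(1) that unfolding lin_bdd_def by blast
  have lift: "t (psi p) = phi p" if p: "p \<in> mcar P" for p
  proof -
    have fin: "finite {i. r p i \<noteq> 0}"
      using rp[OF p] by simp
    have "phi p = phi (s (r p))"
      using r(2)[OF p] by simp
    also have "\<dots> = phi (lin_ext P (\<lambda>i. s (?b i)) (r p))"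
      using lin_bdd_l1z_eq[OF P.vec_sp_axioms s(1) rp[OF p]] by simp
    also have "\<dots> = lin_ext X (\<lambda>i. phi (s (?b i))) (r p)"
      by (rule lin_bdd_lin_ext_comp[OF P.vec_sp_axioms X.vec_sp_axioms phi sb fin])
    also have "\<dots> = lin_ext X (\<lambda>i. t (y i)) (r p)"
      by (simp only: y(2))
    also have "\<dots> = t (psi p)"
      unfolding psi_def
      by (rule lin_bdd_lin_ext_comp[OF Y.vec_sp_axioms X.vec_sp_axioms t(1) y(1) fin, symmetric])
    finally show ?thesis by simp
  qed
  have bound: "mnorm Y (psi p) \<le> (?K + d) * (1 + d) * mnorm P p" if p: "p \<in> mcar P" for p
  proof -
    have "mnorm Y (psi p) \<le> (?K + d) * mnorm (l1z L) (r p)"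
      unfolding psi_def by (rule Y.norm_lin_ext_le[OF rp[OF p]]) (use y in auto)
    also have "\<dots> \<le> (?K + d) * ((1 + d) * mnorm P p)"
      using K d(1) norm_le_of_opnorm_le[OF r(1) P less_imp_le[OF r(3)] p] by (intro mult_left_mono) auto
    finally show ?thesis by (simp add: mult.assoc)
  qed
  have E: "lin_bdd (l1z L) Y (lin_ext Y y)"
    by (rule Y.lin_bdd_lin_ext) (use y in auto)
  have "lin_bdd P Y psi"
    using E r(1) rp unfolding lin_bdd_def psi_def
    by (intro conjI ballI allI exI[of _ "(?K + d) * (1 + d)"] bound[unfolded psi_def]) (auto simp del: l1z_simps)
  moreover have "opnorm P Y psi \<le> (?K + d) * (1 + d)"
    by (rule opnorm_le) (use K d(1) bound in auto)
  ultimately show "\<exists>psi. lin_bdd P Y psi \<and> (\<forall>p\<in>mcar P. t (psi p) = phi p) \<and> opnorm P Y psi < opnorm P X phi + e"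
    using lift d(2) by (intro exI[of _ psi]) auto
qed

section \<open>The canonical cover of a normed space\<close>

definition uball :: "'x nmod \<Rightarrow> 'x set" where
  "uball P = {x \<in> mcar P. mnorm P x \<le> 1}"

text \<open>The unit vector with index \<open>x\<close> is sent to \<open>x\<close> itself. Indices
  outside the ball receive the value zero, as \<open>lin_ext\<close> takes a family over the whole
  type.\<close>

definition ball_sum :: "'x nmod \<Rightarrow> ('x \<Rightarrow> complex) \<Rightarrow> 'x" where
  "ball_sum P = lin_ext P (\<lambda>x. if x \<in> uball P then x else mzero P)"

context nrm_sp
begin

lemma ball_sum_lin_bdd: "lin_bdd (l1z (uball M)) M (ball_sum M)"
  unfolding ball_sum_def by (rule lin_bdd_lin_ext[where C = 1]) (auto simp: uball_def)

text \<open>A nonzero \<open>x\<close> is the image of \<open>mnorm M x\<close> times the unit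
  vector indexed by its normalisation, so it even has a lift of exactly its own norm; for
  \<open>x\<close> zero the index is zero, which also lies in the ball.\<close>

lemma ball_sum_coisometric: "coisometric (l1z (uball M)) M (ball_sum M)"
  unfolding coisometric_def
proof (intro conjI ballI allI impI)
  show "opnorm (l1z (uball M)) M (ball_sum M) \<le> 1"
    unfolding ball_sum_def by (intro opnorm_le norm_lin_ext_le) (auto simp: uball_def)
  fix x and e :: real
  assume x: "x \<in> mcar M" and e: "0 < e"
  define u where "u = (if x = mzero M then x else msmul M (of_real (1 / mnorm M x)) x)"
  have nz: "mnorm M x \<noteq> 0" if "x \<noteq> mzero M"
    using that norm_eq_0[OF x] by simp
  have u: "u \<in> uball M"
    using x nz by (auto simp: u_def uball_def norm_smul norm_divide)
  have "msmul M (of_real (mnorm M x)) u = x"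
    using x nz by (auto simp: u_def smul_smul simp flip: of_real_mult)
  then have "ball_sum M (\<lambda>i. of_real (mnorm M x) * delta u i) = x"
    using u unfolding ball_sum_def by (subst lin_ext_smul_delta) (auto simp: uball_def)
  moreover have "(\<lambda>i. of_real (mnorm M x) * delta u i) \<in> mcar (l1z (uball M))"
    by (rule smul_delta_in_l1z[OF u])
  moreover have "mnorm (l1z (uball M)) (\<lambda>i. of_real (mnorm M x) * delta u i) < mnorm M x + e"
    using e x by (simp add: norm_smul_delta)
  ultimately show "\<exists>y\<in>mcar (l1z (uball M)). ball_sum M y = x \<and> mnorm (l1z (uball M)) y < mnorm M x + e"
    by blast
qed

text \<open>The right inverses are liftings of the identity, whose norm is at most one, through the
  canonical cover.\<close>

lemma ext_proj_Nor_imp_near_retract: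
  assumes "ext_proj_Nor M TYPE('a \<Rightarrow> complex) TYPE('a)"
  shows "near_retract M (l1z (uball M))"
proof -
  have id: "lin_bdd M M (\<lambda>x. x)"
    unfolding lin_bdd_def by (auto intro: exI[of _ 1])
  have id_le: "opnorm M M (\<lambda>x. x) \<le> 1"
    by (rule opnorm_le) auto
  have "\<exists>r. lin_bdd M (l1z (uball M)) r \<and> (\<forall>x\<in>mcar M. ball_sum M (r x) = x) \<and>
      opnorm M (l1z (uball M)) r < 1 + e" if "0 < e" for e
  proof -
    have "\<exists>r. lin_bdd M (l1z (uball M)) r \<and> (\<forall>x\<in>mcar M. ball_sum M (r x) = x) \<and>
      opnorm M (l1z (uball M)) r < opnorm M M (\<lambda>x. x) + e"
      using assms[unfolded ext_proj_Nor_def, rule_format, of "l1z (uball M)" M "ball_sum M" "\<lambda>x. x" e]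
        id that ball_sum_lin_bdd ball_sum_coisometric nrm_sp_l1z[of "uball M"] nrm_sp_axioms
      by (simp add: normed_sp_iff)
    then show ?thesis
      using id_le by force
  qed
  then show ?thesis
    unfolding near_retract_def using ball_sum_lin_bdd ball_sum_coisometric
    by (auto simp: coisometric_def)
qed

end

section \<open>Coordinate subspaces\<close>

lemma coord_simps [simp]:
  "mzero (coord M n) = mzero M" "madd (coord M n) = madd M" "msmul (coord M n) = msmul M"
  "mact (coord M n) = mact M" "mnorm (coord M n) = mnorm M"
  by (simp_all add: coord_def)

definition with_action :: "nat \<Rightarrow> 'x nmod \<Rightarrow> 'x nmod" where
  "with_action n M = M\<lparr>mact := \<lambda>a. msmul M (a n)\<rparr>"

lemma with_action_simps [simp]:
  "mcar (with_action n M) = mcar M" "mzero (with_action n M) = mzero M"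
  "madd (with_action n M) = madd M" "msmul (with_action n M) = msmul M"
  "mact (with_action n M) a = msmul M (a n)" "mnorm (with_action n M) = mnorm M"
  by (simp_all add: with_action_def)

lemma (in seq_alg) in_H_with_action:
  assumes "nrm_sp M"
  shows "in_H A nA (with_action n M)"
proof (rule in_H_single_coordinate)
  interpret nrm_sp M by fact
  show "nrm_sp (with_action n M)"
    by unfold_locales
      (simp_all add: add_assoc smul_smul smul_add_left smul_add_right norm_eq_0 norm_smul
        norm_triangle, rule add_comm)
qed auto

context H_mod
begin

text \<open>\<open>pv n\<close> acts as an idempotent, so its image is its set of fixed points. This
  form of the carrier is an equation and easier to verify.\<close>

lemma mcar_coord: "mcar (coord M n) = {x \<in> mcar M. mact M (pv n) x = x}"
  by (force simp: coord_def pv_pv)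

lemma pv_act_in_coord [simp]: "x \<in> mcar M \<Longrightarrow> mact M (pv n) x \<in> mcar (coord M n)"
  by (simp add: mcar_coord pv_pv)

lemma act_coord: "a \<in> A \<Longrightarrow> x \<in> mcar (coord M n) \<Longrightarrow> mact M a x = msmul M (a n) x"
  using act_pv[of a x n] by (simp add: mcar_coord)

lemma nrm_sp_coord: "nrm_sp (coord M n)"
  by unfold_locales
    (auto simp: mcar_coord act_add act_smul add_assoc smul_smul smul_add_left smul_add_right
      norm_eq_0 norm_smul norm_triangle intro: add_comm)

lemma in_H_coord: "in_H A nA (coord M n)"
  by (rule in_H_single_coordinate[OF nrm_sp_coord]) (simp add: act_coord)

text \<open>The canonical cover of the coordinate subspace becomes a morphism once its source acts
  through the \<open>n\<close>-th entry. The contractive projection of \<open>M\<close> by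
  \<open>pv n\<close> is lifted through it; on the coordinate subspace this projection is the
  identity, so the restricted lifting is a right inverse.\<close>

lemma coord_near_retract:
  fixes n
  assumes proj: "ext_proj_H A nA M TYPE('x \<Rightarrow> complex) TYPE('x)"
  shows "near_retract (coord M n) (l1z (uball (coord M n)))"
proof -
  let ?X = "coord M n"
  let ?L = "l1z (uball ?X)"
  interpret X: nrm_sp ?X by (rule nrm_sp_coord)
  have sum_in: "ball_sum ?X f \<in> mcar ?X" if "f \<in> mcar ?L" for f
    using X.ball_sum_lin_bdd that unfolding lin_bdd_def by blast
  have sum_smul: "ball_sum ?X (msmul ?L c f) = msmul M c (ball_sum ?X f)" if "f \<in> mcar ?L" for c f
    using X.ball_sum_lin_bdd that unfolding lin_bdd_def by simp
  have "lin_bdd (with_action n ?L) ?X (ball_sum ?X)"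
    using X.ball_sum_lin_bdd unfolding lin_bdd_def by simp
  then have sum_morph: "morph A (with_action n ?L) ?X (ball_sum ?X)"
    unfolding morph_def using sum_smul act_coord[OF _ sum_in] by (simp del: l1z_simps)
  have sum_coiso: "coisometric (with_action n ?L) ?X (ball_sum ?X)"
    using X.ball_sum_coisometric unfolding coisometric_def opnorm_def by simp
  have pv_morph: "morph A M ?X (mact M (pv n))"
    unfolding morph_def lin_bdd_def
    using norm_pv_act_le by (auto simp: act_add act_smul pv_act act_pv intro!: exI[of _ 1])
  have pv_le: "opnorm M ?X (mact M (pv n)) \<le> 1"
    by (rule opnorm_le) (auto simp: norm_pv_act_le)
  have "\<exists>r. lin_bdd ?X ?L r \<and> (\<forall>x\<in>mcar ?X. ball_sum ?X (r x) = x) \<and> opnorm ?X ?L r < 1 + e"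
    if e: "0 < e" for e
  proof -
    obtain psi where psi: "morph A M (with_action n ?L) psi"
      "\<And>x. x \<in> mcar M \<Longrightarrow> ball_sum ?X (psi x) = mact M (pv n) x"
      "opnorm M (with_action n ?L) psi < opnorm M ?X (mact M (pv n)) + e"
      using proj[unfolded ext_proj_H_def, rule_format,
          of "with_action n ?L" ?X "ball_sum ?X" "mact M (pv n)" e]
        in_H_with_action[OF nrm_sp_l1z] in_H_coord sum_morph sum_coiso pv_morph e
      by blast
    have lin: "lin_bdd M ?L psi"
      using psi(1) unfolding morph_def lin_bdd_def by (simp del: l1z_simps)
    have op: "opnorm M ?L psi < 1 + e"
      using psi(3) pv_le by (simp add: opnorm_def)
    have "lin_bdd ?X ?L psi"
      using lin unfolding lin_bdd_def by (auto simp: mcar_coord simp del: l1z_simps)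
    moreover have "opnorm ?X ?L psi \<le> opnorm M ?L psi"
      by (rule opnorm_le)
        (use opnorm_ge0[OF lin nrm_sp_axioms] norm_le_opnorm[OF lin nrm_sp_axioms] in
          \<open>auto simp: mcar_coord\<close>)
    ultimately show ?thesis
      using psi(2) op by (intro exI[of _ psi]) (auto simp: mcar_coord)
  qed
  then show ?thesis
    unfolding near_retract_def using X.ball_sum_lin_bdd X.ball_sum_coisometric
    by (auto simp: coisometric_def)
qed

end

section \<open>Topologically projective modules are of finite type\<close>

definition c0_renorm :: "'x nmod \<Rightarrow> 'x nmod" where
  "c0_renorm M = M\<lparr>mnorm := \<lambda>x. SUP n. mnorm M (mact M (pv n) x)\<rparr>"

lemma c0_renorm_simps [simp]:
  "mcar (c0_renorm M) = mcar M" "mzero (c0_renorm M) = mzero M" "madd (c0_renorm M) = madd M"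
  "msmul (c0_renorm M) = msmul M" "mact (c0_renorm M) = mact M"
  "mnorm (c0_renorm M) x = (SUP n. mnorm M (mact M (pv n) x))"
  by (simp_all add: c0_renorm_def)

text \<open>The lower bound one makes summation over the copies contractive; divergence is what
  defeats a bounded lifting.\<close>

definition weights :: "(nat \<Rightarrow> real) set" where
  "weights = {w. (\<forall>n. 1 \<le> w n) \<and> filterlim w at_top sequentially}"

text \<open>The norm of the \<open>n\<close>-th coordinate of \<open>y\<close>: an l_1-sum over the
  copies, as suits the map that adds them up.\<close>

definition wnorm :: "'x nmod \<Rightarrow> nat \<Rightarrow> ((nat \<Rightarrow> real) \<Rightarrow> 'x) \<Rightarrow> real" where
  "wnorm M n y = (\<Sum>w | y w \<noteq> mzero M. w n * mnorm M (mact M (pv n) (y w)))"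

text \<open>There is one copy of the module for each weight. The decay of the weighted coordinates
  makes truncations dense, and finiteness of the support leaves only finitely many weights to
  control at a time.\<close>

definition weighted_sum :: "'x nmod \<Rightarrow> ((nat \<Rightarrow> real) \<Rightarrow> 'x) nmod" where
  "weighted_sum M = \<lparr>
     mcar = {y. (\<forall>w. y w \<in> mcar M) \<and> finite {w. y w \<noteq> mzero M} \<and> {w. y w \<noteq> mzero M} \<subseteq> weights \<and>
       (\<forall>w. (\<lambda>n. w n * mnorm M (mact M (pv n) (y w))) \<longlonglongrightarrow> 0)},
     mzero = (\<lambda>_. mzero M),
     madd = (\<lambda>y z w. madd M (y w) (z w)),
     msmul = (\<lambda>c y w. msmul M c (y w)),
     mact = (\<lambda>a y w. mact M a (y w)),
     mnorm = (\<lambda>y. SUP n. wnorm M n y) \<rparr>"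

lemma weighted_sum_simps [simp]:
  "mzero (weighted_sum M) = (\<lambda>_. mzero M)"
  "madd (weighted_sum M) y z = (\<lambda>w. madd M (y w) (z w))"
  "msmul (weighted_sum M) c y = (\<lambda>w. msmul M c (y w))"
  "mact (weighted_sum M) a y = (\<lambda>w. mact M a (y w))"
  "mnorm (weighted_sum M) y = (SUP n. wnorm M n y)"
  by (simp_all add: weighted_sum_def)

text \<open>The weight is unbounded because both terms of the denominator tend to zero; the second one
  only guards against division by zero.\<close>

lemma weight_exists:
  fixes r :: "nat \<Rightarrow> real"
  assumes r: "\<And>n. 0 \<le> r n" "r \<longlonglongrightarrow> 0" "\<And>n. r n \<le> R" and e: "0 < e"
  shows "\<exists>w\<in>weights. (\<lambda>n. w n * r n) \<longlonglongrightarrow> 0 \<and> (\<forall>n. w n * r n \<le> R + e)"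
proof -
  have R: "0 \<le> R" using r(1)[of 0] r(3)[of 0] by linarith
  \<comment> \<open>With this choice the excess \<open>c * sqrt (r n)\<close> found below is at most
    \<open>e\<close>; adding one avoids division by zero when \<open>R = 0\<close>.\<close>
  define c where "c = e / (sqrt R + 1)"
  have c: "0 < c" "c * sqrt R \<le> e"
  proof -
    have pos: "0 < sqrt R + 1"
      using R by (simp add: add_nonneg_pos)
    then show "0 < c"
      using e by (simp add: c_def)
    have "e * sqrt R \<le> e * (sqrt R + 1)"
      using e by (simp add: distrib_left)
    then show "c * sqrt R \<le> e"
      using pos by (simp add: c_def pos_divide_le_eq)
  qed
  define d where "d n = sqrt (r n) + inverse (real (Suc n))" for n
  have d0: "0 < d n" "sqrt (r n) \<le> d n" for n
    using r(1)[of n] by (auto simp: d_def add_nonneg_pos)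
  have "d \<longlonglongrightarrow> sqrt 0 + 0"
    unfolding d_def by (intro tendsto_add tendsto_real_sqrt r(2) LIMSEQ_inverse_real_of_nat)
  then have "filterlim d (at_right 0) sequentially"
    using d0(1) less_imp_neq[OF d0(1), symmetric] by (auto simp: filterlim_at)
  then have "filterlim (\<lambda>n. inverse (d n)) at_top sequentially"
    by (rule filterlim_compose[OF filterlim_inverse_at_top_right])
  then have "filterlim (\<lambda>n. 1 + c * inverse (d n)) at_top sequentially"
    by (intro filterlim_tendsto_add_at_top[OF tendsto_const]
        filterlim_tendsto_pos_mult_at_top[OF tendsto_const c(1)])
  then have w: "(\<lambda>n. 1 + c * inverse (d n)) \<in> weights"
    using c(1) d0(1) by (auto simp: weights_def less_imp_le)
  \<comment> \<open>As \<open>d n\<close> is at least \<open>sqrt (r n)\<close>, the quotient of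
    \<open>r n\<close> by \<open>d n\<close> is at most \<open>sqrt (r n)\<close>. This is why the
    square root was taken: the weight diverges and the product still tends to zero.\<close>
  have le: "(1 + c * inverse (d n)) * r n \<le> r n + c * sqrt (r n)" for n
  proof -
    have "r n = sqrt (r n) * sqrt (r n)"
      using r(1) by simp
    also have "\<dots> \<le> sqrt (r n) * d n"
      using d0(2) r(1) by (intro mult_left_mono) auto
    finally have "inverse (d n) * r n \<le> sqrt (r n)"
      using d0(1)[of n] by (simp add: field_simps)
    then show ?thesis
      using c(1) by (simp add: distrib_right mult.assoc)
  qed
  have "(\<lambda>n. (1 + c * inverse (d n)) * r n) \<longlonglongrightarrow> 0"
  proof (rule tendsto_sandwich[OF _ _ tendsto_const])
    show "(\<lambda>n. r n + c * sqrt (r n)) \<longlonglongrightarrow> 0"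
      using tendsto_add[OF r(2) tendsto_mult[OF tendsto_const tendsto_real_sqrt[OF r(2)], of c]] by simp
  qed (use le r(1) c(1) d0(1) in \<open>auto simp: less_imp_le\<close>)
  moreover have "(1 + c * inverse (d n)) * r n \<le> R + e" for n
  proof -
    have "c * sqrt (r n) \<le> c * sqrt R"
      using c(1) r(3) by simp
    then show ?thesis
      using le[of n] r(3)[of n] c(2) by linarith
  qed
  ultimately show ?thesis
    using w by (intro bexI[of _ "\<lambda>n. 1 + c * inverse (d n)"]) auto
qed

section \<open>The renormed module, the weighted sum and the summation map\<close>

context H_mod
begin

lemma c0_renorm_in_H:
  "in_H A nA (c0_renorm M)"
  "\<And>x n. x \<in> mcar M \<Longrightarrow> mnorm M (mact M (pv n) x) \<le> mnorm (c0_renorm M) x"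
  "\<And>x C. x \<in> mcar M \<Longrightarrow> (\<And>n. mnorm M (mact M (pv n) x) \<le> C) \<Longrightarrow> mnorm (c0_renorm M) x \<le> C"
proof -
  have act: "act_sp A (c0_renorm M)"
    by unfold_locales
      (simp_all add: add_assoc smul_smul smul_add_left smul_add_right act_add act_smul add_act
        smul_act mult_act, rule add_comm)
  note sup = in_H_sup_norm[OF act, of "\<lambda>n x. mnorm M (mact M (pv n) x)"]
  have *: "mnorm M (mact M (pv n) (madd M x y)) \<le> mnorm M (mact M (pv n) x) + mnorm M (mact M (pv n) y)"
    if "x \<in> mcar M" "y \<in> mcar M" for n x y
    using that by (simp add: act_add norm_triangle)
  have **: "x = mzero M" if "x \<in> mcar M" "\<And>n. mnorm M (mact M (pv n) x) = 0" for x
    by (rule eq_zeroI[OF that(1)]) (use that norm_eq_0 in auto)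
  show "in_H A nA (c0_renorm M)"
    by (rule sup(1)) (use * ** norm_pv_act_tendsto in \<open>auto simp: act_smul norm_smul pv_act\<close>)
  show "mnorm M (mact M (pv n) x) \<le> mnorm (c0_renorm M) x" if "x \<in> mcar M" for x n
    by (rule sup(2)) (use that * ** norm_pv_act_tendsto in \<open>auto simp: act_smul norm_smul pv_act\<close>)
  show "mnorm (c0_renorm M) x \<le> C" if "x \<in> mcar M" "\<And>n. mnorm M (mact M (pv n) x) \<le> C" for x C
    by (rule sup(3)) (use that * ** norm_pv_act_tendsto in \<open>auto simp: act_smul norm_smul pv_act\<close>)
qed

lemma weighted_sumD:
  assumes "y \<in> mcar (weighted_sum M)"
  shows "y w \<in> mcar M" "finite {w. y w \<noteq> mzero M}"
    "y w \<noteq> mzero M \<Longrightarrow> w \<in> weights" "(\<lambda>n. w n * mnorm M (mact M (pv n) (y w))) \<longlonglongrightarrow> 0"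
  using assms by (auto simp: weighted_sum_def)

lemma weights_ge1: "w \<in> weights \<Longrightarrow> 1 \<le> w n"
  by (simp add: weights_def)

lemma weights_nonneg: "w \<in> weights \<Longrightarrow> 0 \<le> w n"
  using weights_ge1[of w n] by linarith

lemma wnorm_eq:
  assumes "finite S" "{w. y w \<noteq> mzero M} \<subseteq> S"
  shows "wnorm M n y = (\<Sum>w\<in>S. w n * mnorm M (mact M (pv n) (y w)))"
  unfolding wnorm_def by (rule sum.mono_neutral_left) (use assms in auto)

text \<open>Decay follows from domination by null sequences on a finite set of weights containing
  the support, so each operation requires only a pointwise estimate.\<close>

lemma weighted_sumI:
  assumes "\<And>w. y w \<in> mcar M" "finite S" "{w. y w \<noteq> mzero M} \<subseteq> S" "S \<subseteq> weights"
    and lim: "\<And>w. w \<in> S \<Longrightarrow> g w \<longlonglongrightarrow> 0"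
    and le: "\<And>w n. w \<in> S \<Longrightarrow> w n * mnorm M (mact M (pv n) (y w)) \<le> g w n"
  shows "y \<in> mcar (weighted_sum M)"
proof -
  have "(\<lambda>n. w n * mnorm M (mact M (pv n) (y w))) \<longlonglongrightarrow> 0" for w
  proof (cases "w \<in> S")
    case True
    then have "w \<in> weights"
      using assms(4) by blast
    show ?thesis
      by (rule tendsto_sandwich[OF _ _ tendsto_const lim[OF True]])
        (use assms(1) weights_nonneg[OF \<open>w \<in> weights\<close>] le[OF True] in auto)
  next
    case False
    then have "y w = mzero M"
      using assms(3) by blast
    then show ?thesis
      by simp
  qed
  moreover have "finite {w. y w \<noteq> mzero M}"
    using assms(2,3) by (rule finite_subset[rotated])
  ultimately show ?thesis
    using assms(1,3,4) unfolding weighted_sum_def by simp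
qed

lemma act_sp_weighted_sum: "act_sp A (weighted_sum M)"
proof unfold_locales
  fix y z c a
  assume y: "y \<in> mcar (weighted_sum M)"
  note yD = weighted_sumD[OF y]
  let ?S = "{w. y w \<noteq> mzero M}"
  let ?g = "\<lambda>y w n. w n * mnorm M (mact M (pv n) (y w))"
  show "msmul (weighted_sum M) c y \<in> mcar (weighted_sum M)"
  proof (rule weighted_sumI[where S = ?S and g = "\<lambda>w n. cmod c * ?g y w n"])
    show "(\<lambda>n. cmod c * ?g y w n) \<longlonglongrightarrow> 0" for w
      by (rule tendsto_mult_right_zero[OF yD(4)])
  qed (use yD in \<open>auto simp: act_smul norm_smul\<close>)
  show "mact (weighted_sum M) a y \<in> mcar (weighted_sum M)" if a: "a \<in> A"
  proof (rule weighted_sumI[where S = ?S and g = "\<lambda>w n. nA a * ?g y w n"])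
    show "(\<lambda>n. nA a * ?g y w n) \<longlonglongrightarrow> 0" for w
      by (rule tendsto_mult_right_zero[OF yD(4)])
    show "?g (mact (weighted_sum M) a y) w n \<le> nA a * ?g y w n" if "w \<in> ?S" for w n
      using mult_right_mono[OF norm_coord_le[OF a, of n], of "?g y w n"] yD(1)[of w] a
        weights_nonneg[OF yD(3)[of w], of n] that
      by (simp add: pv_act norm_smul mult.left_commute)
  qed (use yD a in auto)
  assume z: "z \<in> mcar (weighted_sum M)"
  note zD = weighted_sumD[OF z]
  show "madd (weighted_sum M) y z \<in> mcar (weighted_sum M)"
  proof (rule weighted_sumI[where S = "?S \<union> {w. z w \<noteq> mzero M}" and g = "\<lambda>w n. ?g y w n + ?g z w n"])
    show "(\<lambda>n. ?g y w n + ?g z w n) \<longlonglongrightarrow> 0" for w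
      using tendsto_add[OF yD(4) zD(4)] by simp
    show "?g (madd (weighted_sum M) y z) w n \<le> ?g y w n + ?g z w n"
      if "w \<in> ?S \<union> {w. z w \<noteq> mzero M}" for w n
    proof -
      have "0 \<le> w n"
        using that yD(3) zD(3) weights_nonneg by blast
      then show ?thesis
        using norm_triangle[of "mact M (pv n) (y w)" "mact M (pv n) (z w)"] yD(1)[of w] zD(1)[of w]
        by (simp add: act_add mult_left_mono flip: distrib_left)
    qed
  qed (use yD zD in auto)
  show "madd (weighted_sum M) y z = madd (weighted_sum M) z y"
    using yD(1) zD(1) by (simp add: add_comm)
next
  show "mzero (weighted_sum M) \<in> mcar (weighted_sum M)"
    by (simp add: weighted_sum_def)
qed (simp_all add: weighted_sumD(1) add_assoc smul_smul smul_add_left smul_add_right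
    act_add act_smul add_act smul_act mult_act)

lemma weighted_sum_in_H:
  "in_H A nA (weighted_sum M)"
  "\<And>y n. y \<in> mcar (weighted_sum M) \<Longrightarrow> wnorm M n y \<le> mnorm (weighted_sum M) y"
  "\<And>y C. y \<in> mcar (weighted_sum M) \<Longrightarrow> (\<And>n. wnorm M n y \<le> C) \<Longrightarrow> mnorm (weighted_sum M) y \<le> C"
  "\<And>y n. y \<in> mcar (weighted_sum M) \<Longrightarrow>
    mnorm (weighted_sum M) (mact (weighted_sum M) (pv n) y) = wnorm M n y"
proof -
  have add: "wnorm M n (madd (weighted_sum M) y z) \<le> wnorm M n y + wnorm M n z"
    if y: "y \<in> mcar (weighted_sum M)" and z: "z \<in> mcar (weighted_sum M)" for n y z
  proof -
    note yD = weighted_sumD[OF y] and zD = weighted_sumD[OF z]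
    let ?S = "{w. y w \<noteq> mzero M} \<union> {w. z w \<noteq> mzero M}"
    have "w n * mnorm M (mact M (pv n) (madd M (y w) (z w))) \<le>
        w n * mnorm M (mact M (pv n) (y w)) + w n * mnorm M (mact M (pv n) (z w))" if "w \<in> ?S" for w
    proof -
      have "0 \<le> w n"
        using that yD(3) zD(3) weights_nonneg by blast
      then show ?thesis
        using norm_triangle[of "mact M (pv n) (y w)" "mact M (pv n) (z w)"] yD(1)[of w] zD(1)[of w]
        by (simp add: act_add mult_left_mono flip: distrib_left)
    qed
    note le = this
    have "wnorm M n (madd (weighted_sum M) y z) =
        (\<Sum>w\<in>?S. w n * mnorm M (mact M (pv n) (madd M (y w) (z w))))"
      using yD(2) zD(2) by (subst wnorm_eq[of ?S]) auto
    also have "\<dots> \<le> (\<Sum>w\<in>?S. w n * mnorm M (mact M (pv n) (y w)) + w n * mnorm M (mact M (pv n) (z w)))"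
      by (rule sum_mono) (rule le)
    also have "\<dots> = wnorm M n y + wnorm M n z"
      using yD(2) zD(2) wnorm_eq[of ?S y n] wnorm_eq[of ?S z n] by (simp add: sum.distrib)
    finally show ?thesis .
  qed
  have smul: "wnorm M n (msmul (weighted_sum M) c y) = cmod c * wnorm M n y"
    if "y \<in> mcar (weighted_sum M)" for n c y
  proof -
    note yD = weighted_sumD[OF that]
    have "wnorm M n (msmul (weighted_sum M) c y) =
        (\<Sum>w | y w \<noteq> mzero M. w n * mnorm M (mact M (pv n) (msmul M c (y w))))"
      using yD(2) by (subst wnorm_eq[of "{w. y w \<noteq> mzero M}"]) auto
    also have "\<dots> = cmod c * wnorm M n y"
      unfolding wnorm_def sum_distrib_left
      using yD(1) by (intro sum.cong) (simp_all add: act_smul norm_smul)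
    finally show ?thesis .
  qed
  have act: "wnorm M n (mact (weighted_sum M) a y) = cmod (a n) * wnorm M n y"
    if "a \<in> A" "y \<in> mcar (weighted_sum M)" for n a y
  proof -
    note yD = weighted_sumD[OF that(2)]
    have "wnorm M n (mact (weighted_sum M) a y) =
        (\<Sum>w | y w \<noteq> mzero M. w n * mnorm M (mact M (pv n) (mact M a (y w))))"
      using yD(2) that(1) by (subst wnorm_eq[of "{w. y w \<noteq> mzero M}"]) auto
    also have "\<dots> = cmod (a n) * wnorm M n y"
      unfolding wnorm_def sum_distrib_left
      using yD(1) that(1) by (intro sum.cong) (simp_all add: pv_act norm_smul)
    finally show ?thesis .
  qed
  have lim: "(\<lambda>n. wnorm M n y) \<longlonglongrightarrow> 0" if "y \<in> mcar (weighted_sum M)" for y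
    unfolding wnorm_def by (rule tendsto_null_sum) (rule weighted_sumD(4)[OF that])
  have zero: "y = mzero (weighted_sum M)"
    if y: "y \<in> mcar (weighted_sum M)" and 0: "\<And>n. wnorm M n y = 0" for y
  proof -
    note yD = weighted_sumD[OF y]
    have "y w = mzero M" for w
    proof (rule ccontr)
      assume w: "y w \<noteq> mzero M"
      have prod0: "w n * mnorm M (mact M (pv n) (y w)) = 0" for n
      proof (rule sum_nonneg_0[OF yD(2), where f = "\<lambda>v. v n * mnorm M (mact M (pv n) (y v))"])
        show "0 \<le> v n * mnorm M (mact M (pv n) (y v))" if "v \<in> {w. y w \<noteq> mzero M}" for v
          using that yD(1) weights_nonneg[OF yD(3)] by simp
        show "(\<Sum>w | y w \<noteq> mzero M. w n * mnorm M (mact M (pv n) (y w))) = 0"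
          using 0[of n] by (simp only: wnorm_def)
      qed (use w in simp)
      have "mnorm M (mact M (pv n) (y w)) = 0" for n
        using prod0[of n] weights_ge1[OF yD(3)[OF w], of n] by auto
      then have "y w = mzero M"
        using yD(1) norm_eq_0 by (intro eq_zeroI[of "y w"]) auto
      with w show False ..
    qed
    then show ?thesis by auto
  qed
  note sup = in_H_sup_norm[OF act_sp_weighted_sum, of "wnorm M", OF add smul act lim zero weighted_sum_simps(5)]
  show "in_H A nA (weighted_sum M)"
    by (rule sup(1))
  show "wnorm M n y \<le> mnorm (weighted_sum M) y" if "y \<in> mcar (weighted_sum M)" for n y
    by (rule sup(2)) (use that in simp_all)
  show "mnorm (weighted_sum M) y \<le> C"
    if "y \<in> mcar (weighted_sum M)" "\<And>n. wnorm M n y \<le> C" for y C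
    by (rule sup(3)) (use that in simp_all)
  show "mnorm (weighted_sum M) (mact (weighted_sum M) (pv n) y) = wnorm M n y"
    if "y \<in> mcar (weighted_sum M)" for n y
    by (rule sup(4)) (use that in simp_all)
qed

text \<open>The estimate carries no weights, since they enter in two ways: at least one for
  contractivity of the sum, and larger than the norm bound of a lifting for finite type.\<close>

lemma norm_pv_fsum_le:
  assumes y: "y \<in> mcar (weighted_sum M)"
  shows "mnorm M (mact M (pv n) (fsum M y)) \<le>
    (\<Sum>w | y w \<noteq> mzero M. mnorm M (mact M (pv n) (y w)))"
proof -
  note yD = weighted_sumD[OF y]
  have "mact M (pv n) (fsum M y) = fsum M (\<lambda>w. mact M (pv n) (y w))"
    by (rule fsum_hom[OF vec_sp_axioms vec_sp_axioms]) (use yD in \<open>auto simp: act_add\<close>)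
  also have "mnorm M \<dots> \<le> (\<Sum>w | y w \<noteq> mzero M. mnorm M (mact M (pv n) (y w)))"
    by (rule norm_fsum_le) (use yD in auto)
  finally show ?thesis .
qed

lemma norm_pv_fsum_le_wnorm:
  assumes y: "y \<in> mcar (weighted_sum M)"
  shows "mnorm M (mact M (pv n) (fsum M y)) \<le> wnorm M n y"
proof -
  note yD = weighted_sumD[OF y]
  have "mnorm M (mact M (pv n) (y w)) \<le> w n * mnorm M (mact M (pv n) (y w))" if "y w \<noteq> mzero M" for w
    using mult_right_mono[OF weights_ge1[OF yD(3)[OF that], of n], of "mnorm M (mact M (pv n) (y w))"] yD(1)
    by simp
  then have "(\<Sum>w | y w \<noteq> mzero M. mnorm M (mact M (pv n) (y w))) \<le> wnorm M n y"
    unfolding wnorm_def by (intro sum_mono) simp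
  with norm_pv_fsum_le[OF y] show ?thesis
    by (rule order_trans)
qed

lemma fsum_le_renorm:
  assumes "y \<in> mcar (weighted_sum M)"
  shows "mnorm (c0_renorm M) (fsum M y) \<le> mnorm (weighted_sum M) y"
proof (rule c0_renorm_in_H(3))
  show "mnorm M (mact M (pv n) (fsum M y)) \<le> mnorm (weighted_sum M) y" for n
    using norm_pv_fsum_le_wnorm[OF assms] weighted_sum_in_H(2)[OF assms] by (rule order_trans)
qed (simp add: weighted_sumD(1)[OF assms])

lemma fsum_morph: "morph A (weighted_sum M) (c0_renorm M) (fsum M)"
  unfolding morph_def lin_bdd_def
proof (intro conjI ballI allI exI[of _ 1])
  fix y z c a
  assume y: "y \<in> mcar (weighted_sum M)"
  note yD = weighted_sumD[OF y]
  show "fsum M y \<in> mcar (c0_renorm M)"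
    using yD by simp
  show "fsum M (msmul (weighted_sum M) c y) = msmul (c0_renorm M) c (fsum M y)"
    using fsum_hom[OF vec_sp_axioms vec_sp_axioms, of "msmul M c" y] yD by (simp add: smul_add_right)
  show "fsum M (mact (weighted_sum M) a y) = mact (c0_renorm M) a (fsum M y)" if "a \<in> A"
    using fsum_hom[OF vec_sp_axioms vec_sp_axioms, of "mact M a" y] yD that by (simp add: act_add)
  show "mnorm (c0_renorm M) (fsum M y) \<le> 1 * mnorm (weighted_sum M) y"
    using fsum_le_renorm[OF y] by simp
  assume z: "z \<in> mcar (weighted_sum M)"
  show "fsum M (madd (weighted_sum M) y z) = madd (c0_renorm M) (fsum M y) (fsum M z)"
    using fsum_add[of y z] yD weighted_sumD[OF z] by simp
qed

lemma fsum_coisometric: "coisometric (weighted_sum M) (c0_renorm M) (fsum M)"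
  unfolding coisometric_def
proof (intro conjI ballI allI impI)
  show "opnorm (weighted_sum M) (c0_renorm M) (fsum M) \<le> 1"
    by (rule opnorm_le) (use fsum_le_renorm in auto)
  fix x and e :: real
  assume "x \<in> mcar (c0_renorm M)" and e: "0 < e"
  then have x: "x \<in> mcar M" by simp
  let ?R = "mnorm (c0_renorm M) x"
  have "\<exists>w\<in>weights. (\<lambda>n. w n * mnorm M (mact M (pv n) x)) \<longlonglongrightarrow> 0 \<and>
      (\<forall>n. w n * mnorm M (mact M (pv n) x) \<le> ?R + e / 2)"
    by (rule weight_exists)
      (use x e norm_pv_act_tendsto c0_renorm_in_H(2) in \<open>auto simp del: c0_renorm_simps\<close>)
  then obtain w where w: "w \<in> weights" "(\<lambda>n. w n * mnorm M (mact M (pv n) x)) \<longlonglongrightarrow> 0"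
    "\<And>n. w n * mnorm M (mact M (pv n) x) \<le> ?R + e / 2"
    by blast
  define y where "y = (\<lambda>v. if v = w then x else mzero M)"
  have y: "y \<in> mcar (weighted_sum M)"
    by (rule weighted_sumI[where S = "{w}" and g = "\<lambda>w n. w n * mnorm M (mact M (pv n) x)"])
      (use w x in \<open>auto simp: y_def\<close>)
  have "wnorm M n y = w n * mnorm M (mact M (pv n) x)" for n
    by (subst wnorm_eq[of "{w}"]) (auto simp: y_def)
  then have "mnorm (weighted_sum M) y \<le> ?R + e / 2"
    using w(3) by (intro weighted_sum_in_H(3)[OF y]) auto
  moreover have "fsum M y = x"
    unfolding y_def by (rule fsum_single[OF x])
  ultimately show "\<exists>y\<in>mcar (weighted_sum M). fsum M y = x \<and> mnorm (weighted_sum M) y < ?R + e"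
    using y e by (intro bexI[of _ y]) auto
qed

lemma top_proj_H_imp_finite_type:
  assumes proj: "top_proj_H A nA M TYPE((nat \<Rightarrow> real) \<Rightarrow> 'x) TYPE('x)"
  shows "finite_type M"
  unfolding finite_type_def
proof
  fix x
  assume x: "x \<in> mcar M"
  have "mnorm (c0_renorm M) z \<le> 1 * mnorm M z" if "z \<in> mcar M" for z
    using c0_renorm_in_H(3)[OF that norm_pv_act_le[OF that]] by simp
  then have "morph A M (c0_renorm M) (\<lambda>z. z)"
    unfolding morph_def lin_bdd_def by (auto simp del: c0_renorm_simps(6) intro: exI[of _ 1])
  then obtain psi where psi: "morph A M (weighted_sum M) psi"
    and lift: "\<And>z. z \<in> mcar M \<Longrightarrow> fsum M (psi z) = z"
    using proj[unfolded top_proj_H_def, rule_format, of "weighted_sum M" "c0_renorm M" "fsum M" "\<lambda>z. z"]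
      weighted_sum_in_H(1) c0_renorm_in_H(1) fsum_morph fsum_coisometric by blast
  obtain C where C: "\<And>z. z \<in> mcar M \<Longrightarrow> mnorm (weighted_sum M) (psi z) \<le> C * mnorm M z"
    using psi unfolding morph_def lin_bdd_def by blast
  define y where "y = psi x"
  have y: "y \<in> mcar (weighted_sum M)"
    using psi x unfolding morph_def lin_bdd_def y_def by blast
  note yD = weighted_sumD[OF y]
  \<comment> \<open>Finite support enters here: finitely many divergent weights exceed the bound
    from a common index on.\<close>
  have "eventually (\<lambda>n. \<forall>w\<in>{w. y w \<noteq> mzero M}. \<bar>C\<bar> + 1 \<le> w n) sequentially"
  proof (rule eventually_ball_finite[OF yD(2)])
    show "\<forall>w\<in>{w. y w \<noteq> mzero M}. \<forall>\<^sub>F n in sequentially. \<bar>C\<bar> + 1 \<le> w n"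
      using yD(3) by (auto simp: weights_def filterlim_at_top)
  qed
  then obtain N where N: "\<And>n w. n \<ge> N \<Longrightarrow> y w \<noteq> mzero M \<Longrightarrow> \<bar>C\<bar> + 1 \<le> w n"
    unfolding eventually_sequentially by blast
  have "mact M (pv n) x = mzero M" if "n \<ge> N" for n
  proof -
    let ?r = "mnorm M (mact M (pv n) x)"
    have "(\<bar>C\<bar> + 1) * ?r \<le> (\<bar>C\<bar> + 1) * (\<Sum>w | y w \<noteq> mzero M. mnorm M (mact M (pv n) (y w)))"
      using norm_pv_fsum_le[OF y, of n] lift[OF x] by (intro mult_left_mono) (auto simp: y_def)
    also have "\<dots> \<le> wnorm M n y"
      unfolding wnorm_def sum_distrib_left
      using N[OF that] yD(1) by (intro sum_mono mult_right_mono) auto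
    \<comment> \<open>As \<open>psi\<close> commutes with \<open>pv n\<close>, the bound
      \<open>C\<close> can be applied to the \<open>n\<close>-th coordinate of \<open>x\<close>
      instead of \<open>x\<close>. The factor \<open>\<bar>C\<bar> + 1\<close> on the left then
      forces that coordinate to vanish.\<close>
    also have "wnorm M n y = mnorm (weighted_sum M) (psi (mact M (pv n) x))"
      using weighted_sum_in_H(4)[OF y, of n] psi x unfolding morph_def y_def by simp
    also have "\<dots> \<le> C * ?r"
      using C x by simp
    also have "\<dots> \<le> \<bar>C\<bar> * ?r"
      using x by (intro mult_right_mono) auto
    finally have "?r \<le> 0"
      by (simp add: distrib_right)
    then have "?r = 0"
      using x by (intro antisym) auto
    then show ?thesis
      using x norm_eq_0 by simp
  qed
  then show "\<exists>N. \<forall>n\<ge>N. mact M (pv n) x = mzero M"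
    by blast
qed

end

section \<open>Gluing liftings of the coordinates\<close>

lemma restrict_to_coord:
  assumes "H_mod A nA M" "H_mod A nA N" "morph A M N f"
  shows "lin_bdd (coord M n) (coord N n) f"
proof -
  interpret M: H_mod A nA M by fact
  interpret N: H_mod A nA N by fact
  have f: "\<And>x. x \<in> mcar M \<Longrightarrow> f x \<in> mcar N"
    "\<And>a x. a \<in> A \<Longrightarrow> x \<in> mcar M \<Longrightarrow> f (mact M a x) = mact N a (f x)"
    using assms(3) unfolding morph_def lin_bdd_def by blast+
  have "f x \<in> mcar (coord N n)" if "x \<in> mcar (coord M n)" for x
    using that f(1)[of x] f(2)[of "pv n" x] by (simp add: M.mcar_coord N.mcar_coord)
  moreover obtain C where "\<And>x. x \<in> mcar M \<Longrightarrow> mnorm N (f x) \<le> C * mnorm M x"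
    using assms(3) unfolding morph_def lin_bdd_def by blast
  ultimately show ?thesis
    using assms(3) unfolding morph_def lin_bdd_def by (auto simp: M.mcar_coord intro!: exI[of _ C])
qed

text \<open>A lift in \<open>M\<close> is cut down to its \<open>n\<close>-th coordinate. It remains
  a lift because the morphism commutes with \<open>pv n\<close>, and its norm does not
  increase.\<close>

lemma coisometric_coord:
  assumes "H_mod A nA M" "H_mod A nA N" "morph A M N f" "coisometric M N f"
  shows "coisometric (coord M n) (coord N n) f"
  unfolding coisometric_def
proof (intro conjI ballI allI impI)
  interpret M: H_mod A nA M by fact
  interpret N: H_mod A nA N by fact
  have lin: "lin_bdd M N f" and f: "\<And>a x. a \<in> A \<Longrightarrow> x \<in> mcar M \<Longrightarrow> f (mact M a x) = mact N a (f x)"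
    using assms(3) unfolding morph_def by blast+
  have "opnorm M N f \<le> 1"
    using assms(4) by (simp add: coisometric_def)
  then show "opnorm (coord M n) (coord N n) f \<le> 1"
    using norm_le_of_opnorm_le[OF lin M.nrm_sp_axioms, of 1] by (intro opnorm_le) (auto simp: M.mcar_coord)
  fix x and e :: real
  assume x: "x \<in> mcar (coord N n)" and e: "0 < e"
  then obtain y where y: "y \<in> mcar M" "f y = x" "mnorm M y < mnorm N x + e"
    using assms(4) unfolding coisometric_def N.mcar_coord by blast
  have "f (mact M (pv n) y) = x"
    using y x f[of "pv n" y] by (simp add: N.mcar_coord)
  moreover have "mnorm M (mact M (pv n) y) < mnorm N x + e"
    using M.norm_pv_act_le[OF y(1), of n] y(3) by linarith
  ultimately show "\<exists>y\<in>mcar (coord M n). f y = x \<and> mnorm (coord M n) y < mnorm (coord N n) x + e"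
    using y(1) by (intro bexI[of _ "mact M (pv n) y"]) auto
qed

text \<open>\<open>pv m\<close> annihilates the coordinate subspaces of all other indices. A glued
  vector is therefore known through its coordinates.\<close>

lemma (in H_mod) pv_fsum_coord:
  assumes fin: "finite {n. g n \<noteq> mzero M}" and g: "\<And>n. g n \<in> mcar (coord M n)"
  shows "mact M (pv m) (fsum M g) = g m"
proof -
  have gM: "g n \<in> mcar M" "mact M (pv n) (g n) = g n" for n
    using g[of n] by (simp_all add: mcar_coord)
  have "mact M (pv m) (fsum M g) = fsum M (\<lambda>n. mact M (pv m) (g n))"
    by (rule fsum_hom[OF vec_sp_axioms vec_sp_axioms]) (use gM fin in \<open>auto simp: act_add\<close>)
  also have "(\<lambda>n. mact M (pv m) (g n)) = (\<lambda>n. if n = m then g m else mzero M)"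
    using pv_pv[OF gM(1)] gM(2) by (metis (mono_tags))
  finally show ?thesis
    using fsum_single[OF gM(1), of m m] by simp
qed

lemma (in H_mod) coord_proj_imp_ext_proj_H:
  assumes proj: "\<And>n. ext_proj_Nor (coord M n) TYPE('y) TYPE('z)" and ft: "finite_type M"
  shows "ext_proj_H A nA M TYPE('y) TYPE('z)"
  unfolding ext_proj_H_def
proof (intro allI impI, elim conjE)
  fix Y :: "'y nmod" and X :: "'z nmod" and t phi and e :: real
  assume "in_H A nA Y" "in_H A nA X" and t: "morph A Y X t" and coiso: "coisometric Y X t"
    and phi: "morph A M X phi" and e: "0 < e"
  then interpret Y: H_mod A nA Y + X: H_mod A nA X
    by (simp_all add: H_mod_def H_mod_axioms_def seq_alg_axioms)
  note M = H_mod_axioms and Y = Y.H_mod_axioms and X = X.H_mod_axioms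
  have tl: "lin_bdd Y X t" and tact: "\<And>a y. a \<in> A \<Longrightarrow> y \<in> mcar Y \<Longrightarrow> t (mact Y a y) = mact X a (t y)"
    using t unfolding morph_def by blast+
  have pl: "lin_bdd M X phi" and pact: "\<And>a y. a \<in> A \<Longrightarrow> y \<in> mcar M \<Longrightarrow> phi (mact M a y) = mact X a (phi y)"
    using phi unfolding morph_def by blast+
  let ?K = "opnorm M X phi"
  have K: "0 \<le> ?K" by (rule opnorm_ge0[OF pl nrm_sp_axioms])
  \<comment> \<open>One factor \<open>1 + d\<close> pays for the liftings on the coordinates, the
    other for vectors that only almost attain the norm of \<open>phi\<close> there.\<close>
  have "\<exists>d>0. (1 + d) * (1 + d) * ?K < ?K + e"
    by (rule small_perturbation) (use e in auto)
  then obtain d where d: "0 < d" "(1 + d) * (1 + d) * ?K < ?K + e"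
    by blast
  let ?c = "(1 + d) * (1 + d)"
  have c: "0 < ?c" using d(1) by simp

  have pn: "lin_bdd (coord M n) (coord X n) phi" for n
    by (rule restrict_to_coord[OF M X phi])
  let ?Kn = "\<lambda>n. opnorm (coord M n) (coord X n) phi"
  have "\<exists>f. lin_bdd (coord M n) (coord Y n) f \<and> (\<forall>x\<in>mcar (coord M n). t (f x) = phi x) \<and>
      opnorm (coord M n) (coord Y n) f \<le> (1 + d) * ?Kn n" for n
  proof (cases "?Kn n = 0")
    \<comment> \<open>A slack proportional to the coordinate norm is zero here, so projectivity
      cannot be invoked; but \<open>phi\<close> vanishes on this coordinate and lifts to
      zero.\<close>
    case True
    have "phi x = t (mzero Y)" if x: "x \<in> mcar (coord M n)" for x
    proof -
      have "mnorm X (phi x) \<le> 0"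
        using norm_le_opnorm[OF pn nrm_sp_coord x] True by simp
      moreover have "phi x \<in> mcar X"
        using x pl by (simp add: mcar_coord lin_bdd_def)
      moreover have "t (mzero Y) = mzero X"
        by (rule additive_zero[OF Y.vec_sp_axioms X.vec_sp_axioms]) (use tl in \<open>auto simp: lin_bdd_def\<close>)
      ultimately show ?thesis
        using X.norm_eq_0[of "phi x"] X.norm_nonneg[of "phi x"] by (simp add: antisym)
    qed
    moreover have "lin_bdd (coord M n) (coord Y n) (\<lambda>_. mzero Y)"
      unfolding lin_bdd_def by (auto simp: Y.mcar_coord intro!: exI[of _ 0])
    moreover have "opnorm (coord M n) (coord Y n) (\<lambda>_. mzero Y) \<le> 0"
      by (rule opnorm_le) auto
    ultimately show ?thesis
      using True by (intro exI[of _ "\<lambda>_. mzero Y"]) simp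
  next
    case False
    then have "0 < d * ?Kn n"
      using opnorm_ge0[OF pn nrm_sp_coord, of n] d(1) by simp
    then have "\<exists>f. lin_bdd (coord M n) (coord Y n) f \<and> (\<forall>x\<in>mcar (coord M n). t (f x) = phi x) \<and>
      opnorm (coord M n) (coord Y n) f < ?Kn n + d * ?Kn n"
      using proj[of n, unfolded ext_proj_Nor_def, rule_format, of "coord Y n" "coord X n" t phi "d * ?Kn n"]
        Y.nrm_sp_coord X.nrm_sp_coord restrict_to_coord[OF Y X t] coisometric_coord[OF Y X t coiso] pn
      by (simp add: normed_sp_iff)
    then show ?thesis
      by (auto simp: distrib_right intro: less_imp_le)
  qed
  then obtain f where f: "\<And>n. lin_bdd (coord M n) (coord Y n) (f n)"
    and f_lift: "\<And>n x. x \<in> mcar (coord M n) \<Longrightarrow> t (f n x) = phi x"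
    and f_norm: "\<And>n. opnorm (coord M n) (coord Y n) (f n) \<le> (1 + d) * ?Kn n"
    by metis
  have "\<exists>v\<in>mcar (coord M n). mnorm M v \<le> 1 \<and> ?Kn n \<le> (1 + d) * mnorm X (phi v)" for n
    using opnorm_almost_attained[OF pn nrm_sp_coord X.nrm_sp_coord d(1), of n] by simp
  then obtain v where v: "\<And>n. v n \<in> mcar (coord M n)" "\<And>n. mnorm M (v n) \<le> 1"
    "\<And>n. ?Kn n \<le> (1 + d) * mnorm X (phi (v n))"
    by metis

  have f_in: "f n x \<in> mcar (coord Y n)" if "x \<in> mcar (coord M n)" for n x
    using f[of n] that unfolding lin_bdd_def by blast
  have f_add: "f n (madd M x y) = madd Y (f n x) (f n y)"
    if "x \<in> mcar (coord M n)" "y \<in> mcar (coord M n)" for n x y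
    using f[of n] that unfolding lin_bdd_def by simp
  have f_smul: "f n (msmul M c x) = msmul Y c (f n x)" if "x \<in> mcar (coord M n)" for n c x
    using f[of n] that unfolding lin_bdd_def by simp
  have f_zero: "f n (mzero M) = mzero Y" for n
    using f_smul[of "mzero M" n 0] f_in[of "mzero M" n] by (simp add: mcar_coord Y.mcar_coord)
  have in_Y: "y \<in> mcar Y" if "y \<in> mcar (coord Y n)" for y n
    using that by (simp add: Y.mcar_coord)

  \<comment> \<open>Finite type makes the glued sum finite, and likewise the comparison vector
    \<open>h\<close>.\<close>
  have fin: "finite {n. mact M (pv n) x \<noteq> mzero M}" if "x \<in> mcar M" for x
  proof -
    obtain N where N: "\<And>n. n \<ge> N \<Longrightarrow> mact M (pv n) x = mzero M"
      using ft \<open>x \<in> mcar M\<close> unfolding finite_type_def by blast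
    have "{n. mact M (pv n) x \<noteq> mzero M} \<subseteq> {..<N}"
      using N by (metis (mono_tags, lifting) lessThan_iff mem_Collect_eq not_le subsetI)
    then show ?thesis
      by (rule finite_subset) simp
  qed
  define g where "g x n = f n (mact M (pv n) x)" for x n
  define psi where "psi x = fsum Y (g x)" for x
  have g_in: "g x n \<in> mcar (coord Y n)" if "x \<in> mcar M" for x n
    unfolding g_def by (rule f_in[OF pv_act_in_coord[OF that]])
  have g_fin: "finite {n. g x n \<noteq> mzero Y}" if "x \<in> mcar M" for x
    by (rule finite_subset[OF _ fin[OF that]]) (auto simp: g_def f_zero)
  have psi_in: "psi x \<in> mcar Y" if "x \<in> mcar M" for x
    unfolding psi_def using in_Y[OF g_in[OF that]] by simp
  have pv_psi: "mact Y (pv n) (psi x) = g x n" if "x \<in> mcar M" for x n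
    unfolding psi_def by (rule Y.pv_fsum_coord[OF g_fin g_in]) (rule that)+

  have lift: "t (psi x) = phi x" if x: "x \<in> mcar M" for x
  proof (rule X.coord_eqI)
    show "t (psi x) \<in> mcar X" "phi x \<in> mcar X"
      using tl pl psi_in[OF x] x unfolding lin_bdd_def by blast+
    show "mact X (pv n) (t (psi x)) = mact X (pv n) (phi x)" for n
      using f_lift[OF pv_act_in_coord[OF x], of n]
      by (simp flip: tact[OF pv_in psi_in[OF x]] pact[OF pv_in x] add: pv_psi[OF x] g_def)
  qed

  have bound: "mnorm Y (psi x) \<le> ?c * ?K * mnorm M x" if x: "x \<in> mcar M" for x
  proof (rule field_le_epsilon)
    fix r :: real
    assume r: "0 < r"
    let ?r = "\<lambda>n. mnorm M (mact M (pv n) x)"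
    let ?g = "\<lambda>n. msmul M (complex_of_real (?r n)) (v n)"
    \<comment> \<open>Since each \<open>v n\<close> lies in the unit ball, \<open>h\<close> is
      dominated by \<open>x\<close> in every coordinate, while \<open>phi\<close> stretches these
      coordinates almost as much as it can.\<close>
    define h where "h = fsum M ?g"
    have vM: "v n \<in> mcar M" for n
      using v(1)[of n] by (simp add: mcar_coord)
    have gM: "?g n \<in> mcar (coord M n)" for n
      using v(1)[of n] by (simp add: mcar_coord act_smul)
    have gfin: "finite {n. ?g n \<noteq> mzero M}"
      by (rule finite_subset[OF _ fin[OF x]]) (use vM in auto)
    have h: "h \<in> mcar M"
      unfolding h_def using vM by simp
    have pv_h: "mact M (pv n) h = ?g n" for n
      unfolding h_def by (rule pv_fsum_coord[OF gfin gM])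
    have "mnorm M h \<le> mnorm M x"
    proof (rule norm_mono[OF h x])
      show "mnorm M (mact M (pv n) h) \<le> ?r n" for n
        using mult_left_mono[OF v(2)[of n], of "?r n"] x vM by (simp add: pv_h norm_smul)
    qed
    then have "mnorm X (phi h) \<le> ?K * mnorm M x"
      using norm_le_opnorm[OF pl nrm_sp_axioms h] mult_left_mono[OF _ K] by (meson order_trans)
    \<comment> \<open>The error is \<open>r / ?c\<close>, because \<open>y\<close> is multiplied by
      \<open>?c\<close> in the comparison below.\<close>
    moreover obtain y where y: "y \<in> mcar Y" "t y = phi h" "mnorm Y y < mnorm X (phi h) + r / ?c"
    proof -
      have "phi h \<in> mcar X" "0 < r / ?c"
        using pl h r c unfolding lin_bdd_def by (blast, simp)
      then show ?thesis
        using that coiso unfolding coisometric_def by blast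
    qed
    ultimately have y_norm: "?c * mnorm Y y \<le> ?c * ?K * mnorm M x + r"
    proof -
      assume "mnorm X (phi h) \<le> ?K * mnorm M x"
      then have "?c * mnorm Y y \<le> ?c * (?K * mnorm M x + r / ?c)"
        using y(3) c by (intro mult_left_mono) auto
      then show ?thesis
        using c by (simp only: distrib_left mult.assoc) simp
    qed
    \<comment> \<open>Both vectors lie in \<open>Y\<close>, so homogeneity applies. The
      \<open>n\<close>-th coordinate of \<open>psi x\<close> is at most \<open>?c\<close> times that
      of \<open>phi h\<close> in norm, which is the image under the contraction \<open>t\<close> of
      the \<open>n\<close>-th coordinate of \<open>y\<close>.\<close>
    have "mnorm Y (psi x) \<le> mnorm Y (msmul Y (complex_of_real ?c) y)"
    proof (rule Y.norm_mono[OF psi_in[OF x]])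
      show "msmul Y (complex_of_real ?c) y \<in> mcar Y"
        using y(1) by simp
      fix n
      have "mnorm Y (g x n) \<le> (1 + d) * ?Kn n * ?r n"
        using norm_le_of_opnorm_le[OF f nrm_sp_coord f_norm pv_act_in_coord[OF x], of n] by (simp add: g_def)
      also have "\<dots> \<le> (1 + d) * ((1 + d) * mnorm X (phi (v n))) * ?r n"
        using v(3)[of n] d(1) x by (intro mult_right_mono mult_left_mono) auto
      also have "\<dots> = ?c * mnorm X (phi (?g n))"
        using pl vM[of n] x by (simp add: lin_bdd_def X.norm_smul)
      also have "phi (?g n) = t (mact Y (pv n) y)"
        using pact[OF pv_in h, of n] tact[OF pv_in y(1), of n] y(2) by (simp add: pv_h)
      also have "?c * mnorm X (t (mact Y (pv n) y)) \<le> ?c * mnorm Y (mact Y (pv n) y)"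
        using norm_le_of_opnorm_le[OF tl Y.nrm_sp_axioms, of 1 "mact Y (pv n) y"] coiso y(1) c
        by (intro mult_left_mono) (simp_all add: coisometric_def)
      finally show "mnorm Y (mact Y (pv n) (psi x)) \<le> mnorm Y (mact Y (pv n) (msmul Y (complex_of_real ?c) y))"
        using c y(1) by (simp only: pv_psi[OF x] Y.act_smul pv_in Y.norm_smul Y.act_in norm_of_real abs_of_pos)
    qed
    also have "\<dots> = ?c * mnorm Y y"
      using c y(1) by (simp only: Y.norm_smul norm_of_real abs_of_pos)
    finally show "mnorm Y (psi x) \<le> ?c * ?K * mnorm M x + r"
      using y_norm by linarith
  qed

  have "morph A M Y psi"
    unfolding morph_def lin_bdd_def
  proof (intro conjI ballI allI exI[of _ "?c * ?K"])
    fix x y c a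
    assume x: "x \<in> mcar M"
    show "psi x \<in> mcar Y" "mnorm Y (psi x) \<le> ?c * ?K * mnorm M x"
      by (rule psi_in[OF x], rule bound[OF x])
    show "psi (msmul M c x) = msmul Y c (psi x)"
      by (rule Y.coord_eqI)
        (simp_all add: psi_in x pv_psi Y.act_smul g_def act_smul f_smul)
    show "psi (mact M a x) = mact Y a (psi x)" if "a \<in> A"
      by (rule Y.coord_eqI)
        (simp_all add: psi_in x pv_psi Y.pv_act g_def pv_act f_smul that)
    assume y: "y \<in> mcar M"
    show "psi (madd M x y) = madd Y (psi x) (psi y)"
      by (rule Y.coord_eqI)
        (simp_all add: psi_in x y pv_psi Y.act_add g_def act_add f_add)
  qed
  moreover have "opnorm M Y psi \<le> ?c * ?K"
    by (rule opnorm_le) (use c K bound in auto)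
  ultimately show "\<exists>psi. morph A M Y psi \<and> (\<forall>p\<in>mcar M. t (psi p) = phi p) \<and> opnorm M Y psi < ?K + e"
    using lift d(2) by (intro exI[of _ psi]) auto
qed

section \<open>Encoding the test modules\<close>

lemma inj_point_big: "\<exists>i :: 'a \<Rightarrow> 'a big. inj i"
proof
  show "inj (\<lambda>a :: 'a. {\<lambda>(n :: nat, b). if b = a then 1 else 0 :: complex})"
    by (rule injI) (auto simp: fun_eq_iff split: if_splits)
qed

lemma inj_fun_big: "\<exists>i :: ('a \<Rightarrow> complex) \<Rightarrow> 'a big. inj i"
proof
  show "inj (\<lambda>f :: 'a \<Rightarrow> complex. {\<lambda>(n :: nat, b). f b})"
    by (rule injI) (auto simp: fun_eq_iff)
qed

text \<open>A family indexed by weights is encoded by its graph; the exponential makes the entries of a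
  weight nonzero, so that index and value can both be read off.\<close>

lemma inj_family_big: "\<exists>i :: ((nat \<Rightarrow> real) \<Rightarrow> 'a) \<Rightarrow> 'a big. inj i"
proof
  let ?g = "\<lambda>(w :: nat \<Rightarrow> real) (a :: 'a) (n :: nat, b). if b = a then complex_of_real (exp (w n)) else 0"
  have g: "w = w' \<and> a = a'" if "?g w a = ?g w' a'" for w w' a a'
  proof -
    have *: "?g w a (n, a) = ?g w' a' (n, a)" for n
      by (simp only: that)
    have "a = a'"
      using *[of 0] by (simp split: if_split_asm)
    with * show ?thesis
      by (auto simp: fun_eq_iff)
  qed
  show "inj (\<lambda>y :: (nat \<Rightarrow> real) \<Rightarrow> 'a. range (\<lambda>w. ?g w (y w)))"
  proof (rule injI, rule ext)
    fix y z :: "(nat \<Rightarrow> real) \<Rightarrow> 'a" and w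
    assume "range (\<lambda>w. ?g w (y w)) = range (\<lambda>w. ?g w (z w))"
    then have "?g w (y w) \<in> range (\<lambda>w. ?g w (z w))"
      by blast
    then obtain w' where "?g w (y w) = ?g w' (z w')"
      by blast
    then show "y w = z w"
      using g by metis
  qed
qed

text \<open>Projectivity as a hypothesis is tested in \<open>'a big\<close> only, into which all
  constructed test modules embed; as a conclusion it holds for arbitrary types \<open>'y\<close> and
  \<open>'z\<close>.\<close>

theorem theoremI:
  fixes A :: "(nat \<Rightarrow> complex) set" and nA :: "(nat \<Rightarrow> complex) \<Rightarrow> real"
    and X :: "'a nmod"
  assumes "seq_algebra A nA" and "in_H A nA X"
  shows
   "(ext_proj_H A nA X TYPE('a big) TYPE('a big) \<longrightarrow>
        (\<forall>n. ext_proj_Nor (coord X n) TYPE('y) TYPE('z)) \<and> finite_type X)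
    \<and> ((\<forall>n. ext_proj_Nor (coord X n) TYPE('a big) TYPE('a big)) \<and> finite_type X \<longrightarrow>
        ext_proj_H A nA X TYPE('y) TYPE('z))
    \<and> (\<forall>n. (ext_proj_Nor (coord X n) TYPE('a big) TYPE('a big) \<longrightarrow>
              (\<exists>L::'a set. near_retract (coord X n) (l1z L)))
          \<and> ((\<exists>L::'l set. near_retract (coord X n) (l1z L)) \<longrightarrow>
              ext_proj_Nor (coord X n) TYPE('y) TYPE('z)))
    \<and> (top_proj_H A nA X TYPE('a big) TYPE('a big) \<longrightarrow> finite_type X)"
proof -
  interpret H_mod A nA X
    using assms by (simp add: H_mod_def H_mod_axioms_def seq_alg_def)
  obtain i :: "'a \<Rightarrow> 'a big" where i: "inj i"
    using inj_point_big by blast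
  obtain j :: "('a \<Rightarrow> complex) \<Rightarrow> 'a big" where j: "inj j"
    using inj_fun_big by blast
  obtain k :: "((nat \<Rightarrow> real) \<Rightarrow> 'a) \<Rightarrow> 'a big" where k: "inj k"
    using inj_family_big by blast
  have top: "finite_type X" if "top_proj_H A nA X TYPE('a big) TYPE('a big)"
    by (rule top_proj_H_imp_finite_type[OF top_proj_H_transport[OF that k i assms(1)]])
  \<comment> \<open>Any slack gives a bounded lifting; here it is one.\<close>
  have ext_top: "top_proj_H A nA X TYPE('a big) TYPE('a big)"
    if "ext_proj_H A nA X TYPE('a big) TYPE('a big)"
    using that zero_less_one unfolding ext_proj_H_def top_proj_H_def by blast
  have near: "near_retract (coord X n) (l1z (uball (coord X n)))"
    if "ext_proj_Nor (coord X n) TYPE('a big) TYPE('a big)" for n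
    by (rule nrm_sp.ext_proj_Nor_imp_near_retract[OF nrm_sp_coord
          ext_proj_Nor_transport[OF that j i]])
  have ext: "ext_proj_Nor (coord X n) TYPE('y) TYPE('z)"
    if "ext_proj_H A nA X TYPE('a big) TYPE('a big)" for n
    by (rule near_retract_imp_ext_proj_Nor[OF nrm_sp_coord
          coord_near_retract[OF ext_proj_H_transport[OF that j i assms(1)]]])
  \<comment> \<open>The detour through near-retracts replaces the fixed type of the hypothesis by
    \<open>'y\<close> and \<open>'z\<close> before gluing.\<close>
  have glue: "ext_proj_H A nA X TYPE('y) TYPE('z)"
    if "\<And>n. ext_proj_Nor (coord X n) TYPE('a big) TYPE('a big)" "finite_type X"
    by (rule coord_proj_imp_ext_proj_H[OF near_retract_imp_ext_proj_Nor[OF nrm_sp_coord near[OF that(1)]] that(2)])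
  show ?thesis
    using top ext_top near ext glue near_retract_imp_ext_proj_Nor[OF nrm_sp_coord] by blast
qed

end
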